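(* Let $\mathbb{H}_4$ be Sweedler's Hopf algebra with generators $g,x$, let $\cdot:\mathbb{H}_4\otimes R\to R$ be a partial action on an algebra $R$ such that $g\cdot1_R=0$, and put $\Omega:=x\cdot1_R$. Let $\mathbb{H}_4[y,\sigma]$ be the Hopf-Ore extension with $\Delta(y)=y\otimes1+g\otimes y$ (so that $\chi(g)=-1$), let $w\in R$, and let $\cdot:\mathbb{H}_4[y,\sigma]\otimes R\to R$ be the linear map (extending the given one) defined by $$y^ja\cdot r=\sum_{k=0}^{j}(-1)^kq^{-\frac{k(k-1)}{2}}\binom{j}{k}_{q^{-1}}w^{j-k}(g^ka\cdot r)w^k,\qquad q=-1,$$ for $a\in\mathbb{H}_4$, $r\in R$, $j\in\mathbb{N}_0$ (so that $y\cdot1_R=w$). Then this map is a symmetric partial action of $\mathbb{H}_4[y,\sigma]$ on $R$ if and only if $w\Omega+\Omega w\in Z(R)$.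
   Context: $\Bbbk$ is an algebraically closed field of characteristic zero; all algebras are associative unital $\Bbbk$-algebras. Sweedler notation $\Delta(h)=h_1\otimes h_2$ is used; $Z(R)$ is the center of $R$. A (left) partial action of a Hopf algebra $\mathcal{H}$ on an algebra $R$ is a linear map $\cdot:\mathcal{H}\otimes R\to R$, $h\otimes r\mapsto h\cdot r$, such that for all $h,k\in\mathcal{H}$, $r,s\in R$: (PA.1) $1_{\mathcal H}\cdot r=r$; (PA.2) $h\cdot (rs)=(h_1\cdot r)(h_2\cdot s)$; (PA.3) $h\cdot(k\cdot r)=(h_1\cdot 1_R)(h_2k\cdot r)$. It is symmetric if in addition (PA.S) $h\cdot(k\cdot r)=(h_1k\cdot r)(h_2\cdot1_R)$. Sweedler's Hopf algebra is $\mathbb{H}_4=\Bbbk\langle g,x\mid g^2=1,\ x^2=0,\ xg=-gx\rangle$ with $\Delta(g)=g\otimes g$, $\Delta(x)=x\otimes1+g\otimes x$. The Hopf-Ore extension $\mathbb{H}_4[y,\sigma]$: $\sigma$ is the algebra automorphism of $\mathbb{H}_4$ with $\sigma(g)=-g$, $\sigma(x)=-x$ (equivalently $\sigma(a)=\chi(a_1)a_2=ga_1g^{-1}\chi(a_2)$ for the character $\chi$ with $\chi(g)=-1$, $\chi(x)=0$); $\mathbb{H}_4[y,\sigma]$ is the algebra generated by $\mathbb{H}_4$ and $y$ subject to $ya=\sigma(a)y$ for $a\in\mathbb{H}_4$, with Hopf algebra structure extending that of $\mathbb{H}_4$ and $\Delta(y)=y\otimes1+g\otimes y$. Every element is uniquely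 $\sum_{i\ge0}y^ia_i$ with $a_i\in\mathbb{H}_4$. $q$-binomial coefficients: $\binom{0}{0}_q=1$, $\binom{n}{m}_q=0$ if $m>n$ or $m<0$, and $\binom{n}{m}_q=\binom{n-1}{m}_q+q^{n-m}\binom{n-1}{m-1}_q$ for $n\ge1$, $0\le m\le n$. *)

theory Defs
  imports "HOL-Library.Poly_Mapping" "HOL-Computational_Algebra.Polynomial"
begin

section \<open>Vector spaces with a basis, and algebras\<close>

text \<open>The vector space with basis the type \<open>'b\<close> over the field \<open>'k\<close> is
  \<open>'b \<Rightarrow>\<^sub>0 'k\<close>.  The convolution product that \<^theory>\<open>HOL-Library.Poly_Mapping\<close> provides for
  some index types is not used.\<close>

definition pscale :: "'k::field \<Rightarrow> ('b \<Rightarrow>\<^sub>0 'k) \<Rightarrow> ('b \<Rightarrow>\<^sub>0 'k)" where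
  "pscale c u = Poly_Mapping.map ((*) c) u"

abbreviation basis :: "'b \<Rightarrow> ('b \<Rightarrow>\<^sub>0 'k::field)" where
  "basis b \<equiv> Poly_Mapping.single b 1"

lemma lookup_pscale [simp]: "Poly_Mapping.lookup (pscale c u) b = c * Poly_Mapping.lookup u b"
  by (simp add: pscale_def map.rep_eq when_def)

lemma vector_space_pscale: "vector_space pscale"
  by standard (auto intro!: poly_mapping_eqI simp: lookup_add algebra_simps)

global_interpretation pscale: vector_space "pscale :: 'k::field \<Rightarrow> ('b \<Rightarrow>\<^sub>0 'k) \<Rightarrow> _"
  by (rule vector_space_pscale)

definition lin_ext ::
  "('k::field \<Rightarrow> 'v::ab_group_add \<Rightarrow> 'v) \<Rightarrow> ('b \<Rightarrow> 'v) \<Rightarrow> ('b \<Rightarrow>\<^sub>0 'k) \<Rightarrow> 'v" where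
  "lin_ext s f u = (\<Sum>b\<in>Poly_Mapping.keys u. s (Poly_Mapping.lookup u b) (f b))"

definition bilin_ext ::
  "('b \<Rightarrow> 'c \<Rightarrow> ('d \<Rightarrow>\<^sub>0 'k::field)) \<Rightarrow> ('b \<Rightarrow>\<^sub>0 'k) \<Rightarrow> ('c \<Rightarrow>\<^sub>0 'k) \<Rightarrow> ('d \<Rightarrow>\<^sub>0 'k)" where
  "bilin_ext f u v = lin_ext pscale (\<lambda>b. lin_ext pscale (f b) v) u"

definition bilinear_map ::
  "('k::field \<Rightarrow> 'u::ab_group_add \<Rightarrow> 'u) \<Rightarrow> ('k \<Rightarrow> 'v::ab_group_add \<Rightarrow> 'v) \<Rightarrow>
   ('k \<Rightarrow> 'w::ab_group_add \<Rightarrow> 'w) \<Rightarrow> ('u \<Rightarrow> 'v \<Rightarrow> 'w) \<Rightarrow> bool" where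
  "bilinear_map s1 s2 s3 f \<longleftrightarrow>
     (\<forall>u. Vector_Spaces.linear s2 s3 (f u)) \<and> (\<forall>v. Vector_Spaces.linear s1 s3 (\<lambda>u. f u v))"

locale k_algebra = vector_space scale
  for scale :: "'k::field \<Rightarrow> 'v::ab_group_add \<Rightarrow> 'v" +
  fixes mult :: "'v \<Rightarrow> 'v \<Rightarrow> 'v" and unit :: 'v
  assumes mult_bilinear: "bilinear_map scale scale scale mult"
    and mult_assoc: "mult (mult a b) c = mult a (mult b c)"
    and unit_left: "mult unit a = a"
    and unit_right: "mult a unit = a"

definition algebra_hom ::
  "('k::field \<Rightarrow> 'v::ab_group_add \<Rightarrow> 'v) \<Rightarrow> ('v \<Rightarrow> 'v \<Rightarrow> 'v) \<Rightarrow> 'v \<Rightarrow>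
   ('k \<Rightarrow> 'w::ab_group_add \<Rightarrow> 'w) \<Rightarrow> ('w \<Rightarrow> 'w \<Rightarrow> 'w) \<Rightarrow> 'w \<Rightarrow> ('v \<Rightarrow> 'w) \<Rightarrow> bool" where
  "algebra_hom s m e s' m' e' f \<longleftrightarrow>
     Vector_Spaces.linear s s' f \<and> (\<forall>a b. f (m a b) = m' (f a) (f b)) \<and> f e = e'"

primrec alg_pow :: "('v \<Rightarrow> 'v \<Rightarrow> 'v) \<Rightarrow> 'v \<Rightarrow> 'v \<Rightarrow> nat \<Rightarrow> 'v" where
  "alg_pow m e a 0 = e"
| "alg_pow m e a (Suc n) = m a (alg_pow m e a n)"


section \<open>Tensor products\<close>

text \<open>The tensor product of the spaces with bases \<open>'b\<close> and \<open>'c\<close> is the space with basis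
  \<open>'b \<times> 'c\<close>.\<close>

definition tensor :: "('b \<Rightarrow>\<^sub>0 'k::field) \<Rightarrow> ('c \<Rightarrow>\<^sub>0 'k) \<Rightarrow> ('b \<times> 'c \<Rightarrow>\<^sub>0 'k)" where
  "tensor = bilin_ext (\<lambda>b c. basis (b, c))"

text \<open>For a bilinear map \<open>f\<close> and a tensor \<open>t\<close> written in the style of Sweedler as a sum of terms
  \<open>h\<^sub>1 \<otimes> h\<^sub>2\<close>, \<open>sweedler s f t\<close> is the corresponding sum of the \<open>f h\<^sub>1 h\<^sub>2\<close> (formed in a space with
  scalar multiplication \<open>s\<close>), i.e. the image of \<open>t\<close> under the linear map that \<open>f\<close> induces.\<close>

definition sweedler ::
  "('k::field \<Rightarrow> 'v::ab_group_add \<Rightarrow> 'v) \<Rightarrow> (('b \<Rightarrow>\<^sub>0 'k) \<Rightarrow> ('c \<Rightarrow>\<^sub>0 'k) \<Rightarrow> 'v) \<Rightarrow>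
   ('b \<times> 'c \<Rightarrow>\<^sub>0 'k) \<Rightarrow> 'v" where
  "sweedler s f = lin_ext s (\<lambda>(b, c). f (basis b) (basis c))"

definition tmap ::
  "(('b \<Rightarrow>\<^sub>0 'k::field) \<Rightarrow> ('d \<Rightarrow>\<^sub>0 'k)) \<Rightarrow> (('c \<Rightarrow>\<^sub>0 'k) \<Rightarrow> ('e \<Rightarrow>\<^sub>0 'k)) \<Rightarrow>
   ('b \<times> 'c \<Rightarrow>\<^sub>0 'k) \<Rightarrow> ('d \<times> 'e \<Rightarrow>\<^sub>0 'k)" where
  "tmap f g = sweedler pscale (\<lambda>a b. tensor (f a) (g b))"

definition treassoc :: "(('b \<times> 'c) \<times> 'd \<Rightarrow>\<^sub>0 'k::field) \<Rightarrow> ('b \<times> 'c \<times> 'd \<Rightarrow>\<^sub>0 'k)" where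
  "treassoc = lin_ext pscale (\<lambda>((b, c), d). basis (b, c, d))"

definition tmult ::
  "(('b \<Rightarrow>\<^sub>0 'k::field) \<Rightarrow> ('b \<Rightarrow>\<^sub>0 'k) \<Rightarrow> ('b \<Rightarrow>\<^sub>0 'k)) \<Rightarrow>
   (('c \<Rightarrow>\<^sub>0 'k) \<Rightarrow> ('c \<Rightarrow>\<^sub>0 'k) \<Rightarrow> ('c \<Rightarrow>\<^sub>0 'k)) \<Rightarrow>
   ('b \<times> 'c \<Rightarrow>\<^sub>0 'k) \<Rightarrow> ('b \<times> 'c \<Rightarrow>\<^sub>0 'k) \<Rightarrow> ('b \<times> 'c \<Rightarrow>\<^sub>0 'k)" where
  "tmult m m' = bilin_ext (\<lambda>(b, c) (b', c').
     tensor (m (basis b) (basis b')) (m' (basis c) (basis c')))"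


section \<open>Hopf algebras\<close>

text \<open>Every vector space over a field has a basis, so that it is no restriction to consider Hopf
  algebra structures on spaces \<open>'b \<Rightarrow>\<^sub>0 'k\<close>.\<close>

record (overloaded) ('b, 'k::field) hopf =
  hmult :: "('b \<Rightarrow>\<^sub>0 'k) \<Rightarrow> ('b \<Rightarrow>\<^sub>0 'k) \<Rightarrow> ('b \<Rightarrow>\<^sub>0 'k)"
  hone :: "'b \<Rightarrow>\<^sub>0 'k"
  hcomult :: "('b \<Rightarrow>\<^sub>0 'k) \<Rightarrow> ('b \<times> 'b \<Rightarrow>\<^sub>0 'k)"
  hcounit :: "('b \<Rightarrow>\<^sub>0 'k) \<Rightarrow> 'k"
  hantipode :: "('b \<Rightarrow>\<^sub>0 'k) \<Rightarrow> ('b \<Rightarrow>\<^sub>0 'k)"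

abbreviation hpow :: "('b, 'k::field) hopf \<Rightarrow> ('b \<Rightarrow>\<^sub>0 'k) \<Rightarrow> nat \<Rightarrow> ('b \<Rightarrow>\<^sub>0 'k)" where
  "hpow H \<equiv> alg_pow (hmult H) (hone H)"

locale hopf_algebra = k_algebra pscale "hmult H" "hone H"
  for H :: "('b, 'k::field) hopf" +
  assumes comult_hom: "algebra_hom pscale (hmult H) (hone H)
      pscale (tmult (hmult H) (hmult H)) (tensor (hone H) (hone H)) (hcomult H)"
    and counit_hom: "algebra_hom pscale (hmult H) (hone H) (*) (*) 1 (hcounit H)"
    and coassoc: "treassoc (tmap (hcomult H) id (hcomult H h)) = tmap id (hcomult H) (hcomult H h)"
    and counit_left: "sweedler pscale (\<lambda>a b. pscale (hcounit H a) b) (hcomult H h) = h"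
    and counit_right: "sweedler pscale (\<lambda>a b. pscale (hcounit H b) a) (hcomult H h) = h"
    and antipode_linear: "Vector_Spaces.linear pscale pscale (hantipode H)"
    and antipode_left: "sweedler pscale (\<lambda>a b. hmult H (hantipode H a) b) (hcomult H h)
      = pscale (hcounit H h) (hone H)"
    and antipode_right: "sweedler pscale (\<lambda>a b. hmult H a (hantipode H b)) (hcomult H h)
      = pscale (hcounit H h) (hone H)"


section \<open>Partial actions\<close>

text \<open>The algebra \<open>R\<close> is a type of class \<open>{ring, monoid_mult}\<close> rather than \<open>ring_1\<close>, because the
  latter would exclude the zero algebra.\<close>

locale partial_action = hopf_algebra H + R: k_algebra scale "(*)" 1
  for H :: "('b, 'k::field) hopf"
    and scale :: "'k \<Rightarrow> 'r::{ring, monoid_mult} \<Rightarrow> 'r" +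
  fixes act :: "('b \<Rightarrow>\<^sub>0 'k) \<Rightarrow> 'r \<Rightarrow> 'r"
  assumes act_bilinear: "bilinear_map pscale scale scale act"
    and PA1: "act (hone H) r = r"
    and PA2: "act h (r * s) = sweedler scale (\<lambda>h1 h2. act h1 r * act h2 s) (hcomult H h)"
    and PA3: "act h (act k r) =
      sweedler scale (\<lambda>h1 h2. act h1 1 * act (hmult H h2 k) r) (hcomult H h)"

locale symmetric_partial_action = partial_action +
  assumes PAS: "act h (act k r) =
      sweedler scale (\<lambda>h1 h2. act (hmult H h1 k) r * act h2 1) (hcomult H h)"


section \<open>Sweedler's Hopf algebra\<close>

text \<open>The pair \<open>(i, j)\<close> stands for the basis element \<open>g\<^sup>i x\<^sup>j\<close>, an exponent being 1 if the Boolean is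
  true and 0 otherwise.\<close>

type_synonym 'k sw = "bool \<times> bool \<Rightarrow>\<^sub>0 'k"

definition sw_mult :: "'k::field sw \<Rightarrow> 'k sw \<Rightarrow> 'k sw" where
  "sw_mult = bilin_ext (\<lambda>(i, j) (i', j').
     if j \<and> j' then 0
     else pscale (if j \<and> i' then -1 else 1) (basis (i \<noteq> i', j \<or> j')))"

definition sw_one :: "'k::field sw" where "sw_one = basis (False, False)"
definition sw_g :: "'k::field sw" where "sw_g = basis (True, False)"
definition sw_x :: "'k::field sw" where "sw_x = basis (False, True)"

definition sw_comult :: "'k::field sw \<Rightarrow> (bool \<times> bool) \<times> (bool \<times> bool) \<Rightarrow>\<^sub>0 'k" where
  "sw_comult = (let
      mm = tmult sw_mult sw_mult;
      ee = tensor sw_one sw_one;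
      \<Delta>g = tensor sw_g sw_g;
      \<Delta>x = tensor sw_x sw_one + tensor sw_g sw_x
    in lin_ext pscale (\<lambda>(i, j). mm (alg_pow mm ee \<Delta>g (of_bool i)) (alg_pow mm ee \<Delta>x (of_bool j))))"

definition sw_counit :: "'k::field sw \<Rightarrow> 'k" where
  "sw_counit = lin_ext (*) (\<lambda>(i, j). if j then 0 else 1)"

definition sw_antipode :: "'k::field sw \<Rightarrow> 'k sw" where
  "sw_antipode = lin_ext pscale (\<lambda>(i, j).
     sw_mult (alg_pow sw_mult sw_one (- sw_mult sw_g sw_x) (of_bool j))
             (alg_pow sw_mult sw_one sw_g (of_bool i)))"

definition sweedler_hopf :: "(bool \<times> bool, 'k::field) hopf" where
  "sweedler_hopf = \<lparr> hmult = sw_mult, hone = sw_one, hcomult = sw_comult,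
     hcounit = sw_counit, hantipode = sw_antipode \<rparr>"


section \<open>The Hopf-Ore extension\<close>

definition sw_sigma :: "'k::field sw \<Rightarrow> 'k sw" where
  "sw_sigma = lin_ext pscale (\<lambda>(i, j). pscale ((-1) ^ (of_bool i + of_bool j)) (basis (i, j)))"

text \<open>The pair \<open>(n, b)\<close> stands for \<open>y\<^sup>n b\<close>.  Since \<open>y a = \<sigma>(a) y\<close> and \<open>\<sigma>\<close> is an involution, we have
  \<open>(y\<^sup>n a) (y\<^sup>m b) = y\<^sup>n\<^sup>+\<^sup>m \<sigma>\<^sup>m(a) b\<close>.\<close>

type_synonym 'k ore = "nat \<times> bool \<times> bool \<Rightarrow>\<^sub>0 'k"

definition ore_monom :: "nat \<Rightarrow> 'k::field sw \<Rightarrow> 'k ore" where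
  "ore_monom n = lin_ext pscale (\<lambda>b. basis (n, b))"

abbreviation ore_embed :: "'k::field sw \<Rightarrow> 'k ore" where
  "ore_embed \<equiv> ore_monom 0"

definition ore_y :: "'k::field ore" where "ore_y = ore_monom 1 sw_one"
definition ore_one :: "'k::field ore" where "ore_one = ore_embed sw_one"

definition ore_mult :: "'k::field ore \<Rightarrow> 'k ore \<Rightarrow> 'k ore" where
  "ore_mult = bilin_ext (\<lambda>(n, a) (m, b).
     ore_monom (n + m) (sw_mult ((sw_sigma ^^ m) (basis a)) (basis b)))"

definition ore_comult ::
  "'k::field ore \<Rightarrow> (nat \<times> bool \<times> bool) \<times> (nat \<times> bool \<times> bool) \<Rightarrow>\<^sub>0 'k" where
  "ore_comult = (let
      mm = tmult ore_mult ore_mult;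
      ee = tensor ore_one ore_one;
      \<Delta>y = tensor ore_y ore_one + tensor (ore_embed sw_g) ore_y
    in lin_ext pscale (\<lambda>(n, b).
      mm (alg_pow mm ee \<Delta>y n) (tmap ore_embed ore_embed (sw_comult (basis b)))))"

definition ore_counit :: "'k::field ore \<Rightarrow> 'k" where
  "ore_counit = lin_ext (*) (\<lambda>(n, b). if n = 0 then sw_counit (basis b) else 0)"

definition ore_antipode :: "'k::field ore \<Rightarrow> 'k ore" where
  "ore_antipode = lin_ext pscale (\<lambda>(n, b).
     ore_mult (ore_embed (sw_antipode (basis b)))
              (alg_pow ore_mult ore_one (- ore_mult (ore_embed sw_g) ore_y) n))"

definition ore_hopf :: "(nat \<times> bool \<times> bool, 'k::field) hopf" where
  "ore_hopf = \<lparr> hmult = ore_mult, hone = ore_one, hcomult = ore_comult,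
     hcounit = ore_counit, hantipode = ore_antipode \<rparr>"


section \<open>Gaussian binomial coefficients and the centre\<close>

fun qbinom :: "'k::field \<Rightarrow> nat \<Rightarrow> nat \<Rightarrow> 'k" where
  "qbinom q n 0 = 1"
| "qbinom q 0 (Suc m) = 0"
| "qbinom q (Suc n) (Suc m) =
     (if m > n then 0 else qbinom q n (Suc m) + q ^ (n - m) * qbinom q n m)"

definition centre :: "'r::times set" where
  "centre = {z. \<forall>r. z * r = r * z}"


section \<open>The structures defined above are Hopf algebras\<close>

subsection \<open>Multilinear algebra over a basis\<close>


lemma lin_ext_superset:
  assumes "vector_space s" "finite A" "Poly_Mapping.keys u \<subseteq> A"
  shows "lin_ext s f u = (\<Sum>b\<in>A. s (Poly_Mapping.lookup u b) (f b))"
proof -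
  interpret vector_space s by fact
  show ?thesis unfolding lin_ext_def
    by (rule sum.mono_neutral_left) (use assms in \<open>auto simp: in_keys_iff\<close>)
qed

lemma lin_ext_basis: "vector_space s \<Longrightarrow> lin_ext s f (basis b) = f b"
  by (simp add: lin_ext_def vector_space.vector_space_assms)

lemma linear_lin_ext:
  assumes "vector_space s" shows "Vector_Spaces.linear pscale s (lin_ext s f)"
proof -
  interpret vector_space s by fact
  show ?thesis
  proof (rule Vector_Spaces.linear.intro[OF vector_space_pscale assms], unfold_locales, goal_cases)
    case (1 u v)
    let ?A = "Poly_Mapping.keys u \<union> Poly_Mapping.keys v"
    have "Poly_Mapping.keys (u + v) \<subseteq> ?A" by (rule Poly_Mapping.keys_add)
    then show ?case
      using assms by (simp add: lin_ext_superset[of s ?A] lookup_add scale_left_distrib sum.distrib)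
  next
    case (2 c u)
    have "Poly_Mapping.keys (pscale c u) \<subseteq> Poly_Mapping.keys u" by (auto simp: in_keys_iff)
    then show ?case
      using assms by (simp add: lin_ext_superset[of s "Poly_Mapping.keys u"] scale_sum_right)
  qed
qed

lemma linearD:
  assumes "Vector_Spaces.linear s s' f"
  shows "f (u + v) = f u + f v" "f (s c u) = s' c (f u)"
proof -
  interpret Vector_Spaces.linear s s' f by fact
  show "f (u + v) = f u + f v" "f (s c u) = s' c (f u)" by (simp_all add: add scale)
qed

lemma linearI:
  assumes "vector_space s" "vector_space s'" "\<And>u v. f (u + v) = f u + f v" "\<And>c u. f (s c u) = s' c (f u)"
  shows "Vector_Spaces.linear s s' f"
  by (rule Vector_Spaces.linear.intro[OF assms(1,2)], unfold_locales) 
     (use assms in \<open>auto simp: vector_space.vector_space_assms\<close>)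

lemma linear_zero: "Vector_Spaces.linear s s' f \<Longrightarrow> f 0 = 0"
  using linearD(1)[of s s' f 0 0] by simp

lemma linear_minus: "Vector_Spaces.linear s s' f \<Longrightarrow> f (- u) = - f u"
  using linearD(1)[of s s' f u "- u"] linear_zero[of s s' f] by (simp add: eq_neg_iff_add_eq_0 add.commute)

lemma basis_induct [case_names basis add scale]:
  assumes "\<And>b. P (basis b)" "\<And>u v. P u \<Longrightarrow> P v \<Longrightarrow> P (u + v)" "\<And>c u. P u \<Longrightarrow> P (pscale c u)"
  shows "P u"
proof -
  have u: "lin_ext pscale basis u = u"
    by (rule poly_mapping_eqI)
       (auto simp: lin_ext_def lookup_sum lookup_single when_def in_keys_iff if_distrib[of "(*) _"]
             cong: if_cong)
  have "finite A \<Longrightarrow> P (\<Sum>b\<in>A. pscale (Poly_Mapping.lookup u b) (basis b))" for A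
  proof (induction A rule: finite_induct)
    case empty
    show ?case using assms(3)[OF assms(1), of 0] by simp
  qed (simp add: assms)
  then show ?thesis using u by (metis lin_ext_def finite_keys)
qed

lemma lin_ext_fun:
  assumes "vector_space s"
  shows "lin_ext s (\<lambda>b. f b + g b) u = lin_ext s f u + lin_ext s g u"
    and "lin_ext s (\<lambda>b. s c (f b)) u = s c (lin_ext s f u)"
proof -
  interpret vector_space s by fact
  show "lin_ext s (\<lambda>b. f b + g b) u = lin_ext s f u + lin_ext s g u"
    by (simp add: lin_ext_def scale_right_distrib sum.distrib)
  show "lin_ext s (\<lambda>b. s c (f b)) u = s c (lin_ext s f u)"
    by (simp add: lin_ext_def scale_sum_right mult.commute)
qed

lemmas lin_ext_simps [simp] =
  lin_ext_basis[OF vector_space_pscale]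
  linearD[OF linear_lin_ext[OF vector_space_pscale]]
  linear_zero[OF linear_lin_ext[OF vector_space_pscale]]
  linear_minus[OF linear_lin_ext[OF vector_space_pscale]]

lemma bilin_ext_simps [simp]:
  "bilin_ext f (basis b) (basis c) = f b c"
  "bilin_ext f (u + u') v = bilin_ext f u v + bilin_ext f u' v"
  "bilin_ext f (pscale k u) v = pscale k (bilin_ext f u v)"
  "bilin_ext f u (v + v') = bilin_ext f u v + bilin_ext f u v'"
  "bilin_ext f u (pscale k v) = pscale k (bilin_ext f u v)"
  by (simp_all add: bilin_ext_def lin_ext_fun[OF vector_space_pscale])

lemma bilinear_mapI:
  assumes "vector_space s1" "vector_space s2" "vector_space s3"
    "\<And>u u' v. f (u + u') v = f u v + f u' v" "\<And>c u v. f (s1 c u) v = s3 c (f u v)"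
    "\<And>u v v'. f u (v + v') = f u v + f u v'" "\<And>c u v. f u (s2 c v) = s3 c (f u v)"
  shows "bilinear_map s1 s2 s3 f"
  using assms unfolding bilinear_map_def by (auto intro: linearI)

lemma bilinear_mapD:
  assumes "bilinear_map s1 s2 s3 f"
  shows "f (u + u') v = f u v + f u' v" "f (s1 c u) v = s3 c (f u v)"
    "f u (v + v') = f u v + f u v'" "f u (s2 c v) = s3 c (f u v)"
    "f 0 v = 0" "f u 0 = 0" "f (- u) v = - f u v" "f u (- v) = - f u v"
proof -
  have 1: "Vector_Spaces.linear s2 s3 (f u)" and 2: "Vector_Spaces.linear s1 s3 (\<lambda>u. f u v)" for u v
    using assms by (auto simp: bilinear_map_def)
  show "f (u + u') v = f u v + f u' v" "f (s1 c u) v = s3 c (f u v)"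
    "f u (v + v') = f u v + f u v'" "f u (s2 c v) = s3 c (f u v)"
    "f 0 v = 0" "f u 0 = 0" "f (- u) v = - f u v" "f u (- v) = - f u v"
    by (rule linearD[OF 1] linearD[OF 2] linear_zero[OF 1] linear_zero[OF 2]
        linear_minus[OF 1] linear_minus[OF 2])+
qed

lemma bilinear_bilin_ext: "bilinear_map pscale pscale pscale (bilin_ext f)"
  by (rule bilinear_mapI) (simp_all add: vector_space_pscale)

lemmas tensor_simps [simp] = bilinear_mapD[OF bilinear_bilin_ext, of "\<lambda>b c. basis (b, c)", folded tensor_def]

lemma basis_induct2:
  assumes "\<And>a b. P (basis a) (basis b)"
    "\<And>u u' v. P u v \<Longrightarrow> P u' v \<Longrightarrow> P (u + u') v" "\<And>c u v. P u v \<Longrightarrow> P (pscale c u) v"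
    "\<And>u v v'. P u v \<Longrightarrow> P u v' \<Longrightarrow> P u (v + v')" "\<And>c u v. P u v \<Longrightarrow> P u (pscale c v)"
  shows "P u v"
proof -
  have 1: "P u (basis b)" for b by (induction u rule: basis_induct) (rule assms, (assumption+)?)+
  show ?thesis by (induction v rule: basis_induct) (rule 1 assms, (assumption+)?)+
qed

lemma basis_induct3:
  assumes "\<And>a b c. P (basis a) (basis b) (basis c)"
    "\<And>u u' v w. P u v w \<Longrightarrow> P u' v w \<Longrightarrow> P (u + u') v w" "\<And>c u v w. P u v w \<Longrightarrow> P (pscale c u) v w"
    "\<And>u v v' w. P u v w \<Longrightarrow> P u v' w \<Longrightarrow> P u (v + v') w" "\<And>c u v w. P u v w \<Longrightarrow> P u (pscale c v) w"
    "\<And>u v w w'. P u v w \<Longrightarrow> P u v w' \<Longrightarrow> P u v (w + w')" "\<And>c u v w. P u v w \<Longrightarrow> P u v (pscale c w)"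
  shows "P u v w"
proof -
  have 1: "P u v (basis b)" for b
    by (induction u v rule: basis_induct2) (rule assms(1-5), (assumption+)?)+
  show ?thesis by (induction w rule: basis_induct) (rule 1 assms, (assumption+)?)+
qed

lemma tensor_basis: "tensor (basis b) (basis c) = basis (b, c)"
  by (simp add: tensor_def)

lemma tensor_induct [case_names tensor add scale]:
  assumes "\<And>a b. P (tensor a b)" "\<And>u v. P u \<Longrightarrow> P v \<Longrightarrow> P (u + v)" "\<And>c u. P u \<Longrightarrow> P (pscale c u)"
  shows "P t"
proof (induction t rule: basis_induct)
  show "P (basis a)" for a
    using assms(1)[of "basis (fst a)" "basis (snd a)"] by (simp add: tensor_basis)
qed (rule assms, assumption+)+

lemma tmult_simps [simp]:
  "tmult m m' (u + u') v = tmult m m' u v + tmult m m' u' v"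
  "tmult m m' (pscale c u) v = pscale c (tmult m m' u v)"
  "tmult m m' u (v + v') = tmult m m' u v + tmult m m' u v'"
  "tmult m m' u (pscale c v) = pscale c (tmult m m' u v)"
  by (simp_all add: tmult_def)

lemma tensor_induct2:
  assumes "\<And>a b c d. P (tensor a b) (tensor c d)"
    "\<And>u u' v. P u v \<Longrightarrow> P u' v \<Longrightarrow> P (u + u') v" "\<And>c u v. P u v \<Longrightarrow> P (pscale c u) v"
    "\<And>u v v'. P u v \<Longrightarrow> P u v' \<Longrightarrow> P u (v + v')" "\<And>c u v. P u v \<Longrightarrow> P u (pscale c v)"
  shows "P u v"
proof (rule basis_induct2[of P])
  show "P (basis a) (basis b)" for a b
    using assms(1)[of "basis (fst a)" "basis (snd a)" "basis (fst b)" "basis (snd b)"]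
    by (simp add: tensor_basis)
qed (rule assms, assumption+)+

lemma tensor_induct3:
  assumes "\<And>a b c d e f. P (tensor a b) (tensor c d) (tensor e f)"
    "\<And>u u' v w. P u v w \<Longrightarrow> P u' v w \<Longrightarrow> P (u + u') v w" "\<And>c u v w. P u v w \<Longrightarrow> P (pscale c u) v w"
    "\<And>u v v' w. P u v w \<Longrightarrow> P u v' w \<Longrightarrow> P u (v + v') w" "\<And>c u v w. P u v w \<Longrightarrow> P u (pscale c v) w"
    "\<And>u v w w'. P u v w \<Longrightarrow> P u v w' \<Longrightarrow> P u v (w + w')" "\<And>c u v w. P u v w \<Longrightarrow> P u v (pscale c w)"
  shows "P u v w"
proof (rule basis_induct3[of P])
  show "P (basis a) (basis b) (basis c)" for a b c
    using assms(1)[of "basis (fst a)" "basis (snd a)" "basis (fst b)" "basis (snd b)"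
      "basis (fst c)" "basis (snd c)"]
    by (simp add: tensor_basis)
qed (rule assms, assumption+)+

lemma linear_sweedler:
  "vector_space s \<Longrightarrow> Vector_Spaces.linear pscale s (sweedler s f)"
  unfolding sweedler_def by (rule linear_lin_ext)

lemma sweedler_tensor:
  assumes "vector_space s" "bilinear_map pscale pscale s f"
  shows "sweedler s f (tensor a b) = f a b"
  by (induction a b rule: basis_induct2)
     (simp_all add: linearD[OF linear_lin_ext[OF assms(1)]] bilinear_mapD[OF assms(2)]
        tensor_basis sweedler_def lin_ext_basis[OF assms(1)])

lemma sweedler_fun:
  assumes "vector_space s"
  shows "sweedler s (\<lambda>a b. f a b + g a b) t = sweedler s f t + sweedler s g t"
    and "sweedler s (\<lambda>a b. s c (f a b)) t = s c (sweedler s f t)"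
  by (simp_all add: sweedler_def split_def lin_ext_fun[OF assms])

lemma linear_tmap: "Vector_Spaces.linear pscale pscale (tmap f g)"
  unfolding tmap_def by (rule linear_sweedler[OF vector_space_pscale])

lemma tmap_tensor:
  assumes "Vector_Spaces.linear pscale pscale f" "Vector_Spaces.linear pscale pscale g"
  shows "tmap f g (tensor a b) = tensor (f a) (g b)"
  unfolding tmap_def
  by (rule sweedler_tensor[OF vector_space_pscale])
     (rule bilinear_mapI, simp_all add: vector_space_pscale linearD[OF assms(1)] linearD[OF assms(2)])

lemma linear_treassoc: "Vector_Spaces.linear pscale pscale treassoc"
  unfolding treassoc_def by (rule linear_lin_ext[OF vector_space_pscale])

lemma treassoc_tensor: "treassoc (tensor (tensor a b) c) = tensor a (tensor b c)"
  by (induction a b c rule: basis_induct3)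
     (simp_all add: linearD[OF linear_treassoc] tensor_basis, simp add: treassoc_def)

lemma tmult_tensor:
  assumes "bilinear_map pscale pscale pscale m" "bilinear_map pscale pscale pscale m'"
  shows "tmult m m' (tensor a b) (tensor c d) = tensor (m a c) (m' b d)"
proof -
  note M = bilinear_mapD[OF assms(1)] bilinear_mapD[OF assms(2)]
  have "tmult m m' (tensor (basis i) (basis j)) (tensor c d) = tensor (m (basis i) c) (m' (basis j) d)" for i j
    by (induction c d rule: basis_induct2) (simp_all add: M, simp add: tensor_basis tmult_def)
  then show ?thesis
    by (induction a b rule: basis_induct2) (simp_all add: M)
qed

lemma k_algebra_tensor:
  assumes "k_algebra pscale m e" "k_algebra pscale m' e'"
  shows "k_algebra pscale (tmult m m') (tensor e e')"
proof -
  interpret A: k_algebra pscale m e by fact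
  interpret B: k_algebra pscale m' e' by fact
  note T = tmult_tensor[OF A.mult_bilinear B.mult_bilinear]
  show ?thesis
  proof (unfold_locales, goal_cases)
    case 1
    show ?case unfolding tmult_def by (rule bilinear_bilin_ext)
  next
    case (2 a b c)
    show ?case
      by (induction a b c rule: tensor_induct3)
         (simp_all add: T A.mult_assoc B.mult_assoc)
  next
    case (3 a)
    show ?case by (induction a rule: tensor_induct) (simp_all add: T A.unit_left B.unit_left)
  next
    case (4 a)
    show ?case by (induction a rule: tensor_induct) (simp_all add: T A.unit_right B.unit_right)
  qed
qed

lemma algebra_homD:
  assumes "algebra_hom s m e s' m' e' f"
  shows "Vector_Spaces.linear s s' f" "f (m a b) = m' (f a) (f b)" "f e = e'"
    "f (a + b) = f a + f b" "f (s c a) = s' c (f a)" "f 0 = 0" "f (- a) = - f a"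
  using assms unfolding algebra_hom_def by (auto dest: linearD linear_zero linear_minus)

lemma linear_comp:
  "Vector_Spaces.linear s s' f \<Longrightarrow> Vector_Spaces.linear s' s'' g \<Longrightarrow> Vector_Spaces.linear s s'' (\<lambda>u. g (f u))"
  by (rule linearI) (auto simp: linearD Vector_Spaces.linear_def)

lemma algebra_hom_comp:
  "algebra_hom s m e s' m' e' f \<Longrightarrow> algebra_hom s' m' e' s'' m'' e'' g \<Longrightarrow>
   algebra_hom s m e s'' m'' e'' (\<lambda>u. g (f u))"
  unfolding algebra_hom_def by (auto intro: linear_comp)

lemma algebra_hom_id: "vector_space s \<Longrightarrow> algebra_hom s m e s m e id"
  unfolding algebra_hom_def by (auto intro: linearI)

lemma algebra_hom_tmap:
  assumes "bilinear_map pscale pscale pscale m1" "bilinear_map pscale pscale pscale m2"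
    "bilinear_map pscale pscale pscale m1'" "bilinear_map pscale pscale pscale m2'"
    "algebra_hom pscale m1 e1 pscale m1' e1' f" "algebra_hom pscale m2 e2 pscale m2' e2' g"
  shows "algebra_hom pscale (tmult m1 m2) (tensor e1 e2) pscale (tmult m1' m2') (tensor e1' e2') (tmap f g)"
proof -
  note f = algebra_homD[OF assms(5)] and g = algebra_homD[OF assms(6)]
  note T = tmult_tensor[OF assms(1,2)] tmult_tensor[OF assms(3,4)] tmap_tensor[OF f(1) g(1)]
  note L = linearD[OF linear_tmap]
  have "tmap f g (tmult m1 m2 a b) = tmult m1' m2' (tmap f g a) (tmap f g b)" for a b
    by (induction a b rule: tensor_induct2) (simp_all add: T f g L)
  then show ?thesis unfolding algebra_hom_def by (simp add: T f g linear_tmap)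
qed

lemma algebra_hom_treassoc:
  fixes m1 :: "('b \<Rightarrow>\<^sub>0 'a::field) \<Rightarrow> _" and m2 :: "('d \<Rightarrow>\<^sub>0 'a) \<Rightarrow> _" and m3 :: "('e \<Rightarrow>\<^sub>0 'a) \<Rightarrow> _"
  assumes "bilinear_map pscale pscale pscale m1" "bilinear_map pscale pscale pscale m2" "bilinear_map pscale pscale pscale m3"
  shows "algebra_hom pscale (tmult (tmult m1 m2) m3) (tensor (tensor e1 e2) e3)
    pscale (tmult m1 (tmult m2 m3)) (tensor e1 (tensor e2 e3)) treassoc"
proof -
  have b: "bilinear_map pscale pscale pscale (tmult m m')" for m :: "('x \<Rightarrow>\<^sub>0 'a) \<Rightarrow> _" and m' :: "('y \<Rightarrow>\<^sub>0 'a) \<Rightarrow> _"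
    unfolding tmult_def by (rule bilinear_bilin_ext)
  note T = tmult_tensor[OF assms(1,2)] tmult_tensor[OF assms(2,3)] tmult_tensor[OF b assms(3)] tmult_tensor[OF assms(1) b]
    treassoc_tensor
  note L = linearD[OF linear_treassoc]
  have ind: "P u v" if "\<And>a b c a' b' c'. P (tensor (tensor a b) c) (tensor (tensor a' b') c')"
    "\<And>u u' v. P u v \<Longrightarrow> P u' v \<Longrightarrow> P (u + u') v" "\<And>c u v. P u v \<Longrightarrow> P (pscale c u) v"
    "\<And>u v v'. P u v \<Longrightarrow> P u v' \<Longrightarrow> P u (v + v')" "\<And>c u v. P u v \<Longrightarrow> P u (pscale c v)"
    for P and u v :: "('b \<times> 'd) \<times> 'e \<Rightarrow>\<^sub>0 'a"
  proof (rule basis_induct2[of P])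
    show "P (basis a) (basis b)" for a b
      using that(1)[of "basis (fst (fst a))" "basis (snd (fst a))" "basis (snd a)"
        "basis (fst (fst b))" "basis (snd (fst b))" "basis (snd b)"]
      by (simp add: tensor_basis)
  qed (rule that, assumption+)+
  have "treassoc (tmult (tmult m1 m2) m3 a b) = tmult m1 (tmult m2 m3) (treassoc a) (treassoc b)" for a b
    by (induction a b rule: ind) (simp_all add: T L)
  then show ?thesis unfolding algebra_hom_def by (simp add: T linear_treassoc)
qed

text \<open>The Hopf algebra axioms need to be verified on algebra generators only.\<close>

lemma hopf_algebraI:
  assumes alg: "k_algebra pscale (hmult H) (hone H)"
    and comult: "algebra_hom pscale (hmult H) (hone H)
      pscale (tmult (hmult H) (hmult H)) (tensor (hone H) (hone H)) (hcomult H)"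
    and counit: "algebra_hom pscale (hmult H) (hone H) (*) (*) 1 (hcounit H)"
    and anti: "algebra_hom pscale (hmult H) (hone H) pscale (\<lambda>a b. hmult H b a) (hone H) (hantipode H)"
    and gen: "\<And>P u. P (hone H) \<Longrightarrow> (\<And>a. a \<in> G \<Longrightarrow> P a) \<Longrightarrow> (\<And>u v. P u \<Longrightarrow> P v \<Longrightarrow> P (hmult H u v)) \<Longrightarrow>
      (\<And>u v. P u \<Longrightarrow> P v \<Longrightarrow> P (u + v)) \<Longrightarrow> (\<And>c u. P u \<Longrightarrow> P (pscale c u)) \<Longrightarrow> P u"
    and coassoc: "\<And>h. h \<in> G \<Longrightarrow> treassoc (tmap (hcomult H) id (hcomult H h)) = tmap id (hcomult H) (hcomult H h)"
    and counit_l: "\<And>h. h \<in> G \<Longrightarrow> sweedler pscale (\<lambda>a b. pscale (hcounit H a) b) (hcomult H h) = h"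
    and counit_r: "\<And>h. h \<in> G \<Longrightarrow> sweedler pscale (\<lambda>a b. pscale (hcounit H b) a) (hcomult H h) = h"
    and anti_l: "\<And>h. h \<in> G \<Longrightarrow> sweedler pscale (\<lambda>a b. hmult H (hantipode H a) b) (hcomult H h)
      = pscale (hcounit H h) (hone H)"
    and anti_r: "\<And>h. h \<in> G \<Longrightarrow> sweedler pscale (\<lambda>a b. hmult H a (hantipode H b)) (hcomult H h)
      = pscale (hcounit H h) (hone H)"
  shows "hopf_algebra H"
proof -
  interpret A: k_algebra pscale "hmult H" "hone H" by fact
  let ?m = "hmult H" and ?e = "hone H" and ?\<Delta> = "hcomult H" and ?\<epsilon> = "hcounit H" and ?S = "hantipode H"
  note mb = A.mult_bilinear
  note \<Delta> = algebra_homD[OF comult] and \<epsilon> = algebra_homD[OF counit] and S = algebra_homD[OF anti]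
  note M = bilinear_mapD[OF mb]
  note V = vector_space_pscale
  note T = tmult_tensor[OF mb mb]
  have idh: "algebra_hom pscale ?m ?e pscale ?m ?e id" by (rule algebra_hom_id[OF V])
  have tb: "bilinear_map pscale pscale pscale (tmult ?m ?m)"
    unfolding tmult_def by (rule bilinear_bilin_ext)
  note f1 = algebra_homD[OF algebra_hom_comp[OF comult algebra_hom_comp[OF algebra_hom_tmap[OF mb mb tb mb comult idh]
    algebra_hom_treassoc[OF mb mb mb]]]]
  note f2 = algebra_homD[OF algebra_hom_comp[OF comult algebra_hom_tmap[OF mb mb mb tb idh comult]]]
  have coassoc': "treassoc (tmap ?\<Delta> id (?\<Delta> h)) = tmap id ?\<Delta> (?\<Delta> h)" for h
    by (rule gen) (simp_all only: f1(2-) f2(2-) coassoc)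
  have bl: "bilinear_map pscale pscale pscale (\<lambda>a b. pscale (?\<epsilon> a) b)"
    "bilinear_map pscale pscale pscale (\<lambda>a b. pscale (?\<epsilon> b) a)"
    "bilinear_map pscale pscale pscale (\<lambda>a b. ?m (?S a) b)"
    "bilinear_map pscale pscale pscale (\<lambda>a b. ?m a (?S b))"
    by (rule bilinear_mapI;
        simp add: V \<epsilon> S M algebra_simps pscale.scale_left_distrib pscale.scale_right_distrib)+
  note SW = sweedler_tensor[OF V bl(1)] sweedler_tensor[OF V bl(2)]
    sweedler_tensor[OF V bl(3)] sweedler_tensor[OF V bl(4)]
  note SL = linearD[OF linear_sweedler[OF V]]
  have hl: "sweedler pscale (\<lambda>a b. pscale (?\<epsilon> a) b) (tmult ?m ?m t t') =
    ?m (sweedler pscale (\<lambda>a b. pscale (?\<epsilon> a) b) t) (sweedler pscale (\<lambda>a b. pscale (?\<epsilon> a) b) t')" for t t'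
    by (induction t t' rule: tensor_induct2)
       (simp_all add: SW SL M T \<epsilon> mult.commute)
  have hr: "sweedler pscale (\<lambda>a b. pscale (?\<epsilon> b) a) (tmult ?m ?m t t') =
    ?m (sweedler pscale (\<lambda>a b. pscale (?\<epsilon> b) a) t) (sweedler pscale (\<lambda>a b. pscale (?\<epsilon> b) a) t')" for t t'
    by (induction t t' rule: tensor_induct2)
       (simp_all add: SW SL M T \<epsilon> mult.commute)
  have counit_l': "sweedler pscale (\<lambda>a b. pscale (?\<epsilon> a) b) (?\<Delta> h) = h" for h
    by (rule gen) (simp_all add: hl SW SL \<Delta> \<epsilon> counit_l)
  have counit_r': "sweedler pscale (\<lambda>a b. pscale (?\<epsilon> b) a) (?\<Delta> h) = h" for h
    by (rule gen) (simp_all add: hr SW SL \<Delta> \<epsilon> counit_r)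
  have bl': "bilinear_map pscale pscale pscale (\<lambda>c d. ?m (?S c) (?m z d))" for z
    by (rule bilinear_mapI) (simp_all add: V S M)
  have br': "bilinear_map pscale pscale pscale (\<lambda>a b. ?m (?m a z) (?S b))" for z
    by (rule bilinear_mapI) (simp_all add: V S M)
  have bl'': "bilinear_map pscale pscale pscale (\<lambda>c d. ?m (?S c) (?m x (?m y d)))" for x y
    by (rule bilinear_mapI) (simp_all add: V S M)
  have br'': "bilinear_map pscale pscale pscale (\<lambda>a b. ?m a (?m x (?S b)))"
    "bilinear_map pscale pscale pscale (\<lambda>a b. ?m a (?m x (?m y (?S b))))" for x y
    by (rule bilinear_mapI; simp add: V S M)+
  note SW' = sweedler_tensor[OF V bl'] sweedler_tensor[OF V br'] sweedler_tensor[OF V bl'']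
    sweedler_tensor[OF V br''(1)] sweedler_tensor[OF V br''(2)]
  have additive_l: "sweedler pscale (\<lambda>c d. ?m (?S c) (?m (z + z') d)) t =
      sweedler pscale (\<lambda>c d. ?m (?S c) (?m z d)) t + sweedler pscale (\<lambda>c d. ?m (?S c) (?m z' d)) t"
    "sweedler pscale (\<lambda>c d. ?m (?S c) (?m (pscale k z) d)) t =
      pscale k (sweedler pscale (\<lambda>c d. ?m (?S c) (?m z d)) t)" for z z' k t
    by (simp_all add: M sweedler_fun[OF V])
  have additive_r: "sweedler pscale (\<lambda>a b. ?m (?m a (z + z')) (?S b)) t =
      sweedler pscale (\<lambda>a b. ?m (?m a z) (?S b)) t + sweedler pscale (\<lambda>a b. ?m (?m a z') (?S b)) t"
    "sweedler pscale (\<lambda>a b. ?m (?m a (pscale k z)) (?S b)) t =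
      pscale k (sweedler pscale (\<lambda>a b. ?m (?m a z) (?S b)) t)" for z z' k t
    by (simp_all add: M sweedler_fun[OF V])
  have al: "sweedler pscale (\<lambda>a b. ?m (?S a) b) (tmult ?m ?m t t') =
    sweedler pscale (\<lambda>c d. ?m (?S c) (?m (sweedler pscale (\<lambda>a b. ?m (?S a) b) t) d)) t'" for t t'
    by (induction t t' rule: tensor_induct2)
       (simp_all add: SW SW' SL M T S A.mult_assoc sweedler_fun[OF V])
  have ar: "sweedler pscale (\<lambda>a b. ?m a (?S b)) (tmult ?m ?m t t') =
    sweedler pscale (\<lambda>a b. ?m (?m a (sweedler pscale (\<lambda>a b. ?m a (?S b)) t')) (?S b)) t" for t t'
    by (induction t t' rule: tensor_induct2)
       (simp_all add: SW SW' SL M T S A.mult_assoc sweedler_fun[OF V])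
  have anti_l': "sweedler pscale (\<lambda>a b. ?m (?S a) b) (?\<Delta> h) = pscale (?\<epsilon> h) ?e" for h
    by (rule gen)
       (simp_all add: al additive_l SW SL \<Delta> \<epsilon> S A.unit_left anti_l pscale.scale_left_distrib)
  have anti_r': "sweedler pscale (\<lambda>a b. ?m a (?S b)) (?\<Delta> h) = pscale (?\<epsilon> h) ?e" for h
    by (rule gen)
       (simp_all add: ar additive_r SW SL \<Delta> \<epsilon> S A.unit_left A.unit_right anti_r pscale.scale_left_distrib mult.commute)
  show ?thesis
    by (unfold_locales) (use comult counit S(1,4,5) coassoc' counit_l' counit_r' anti_l' anti_r' in auto)
qed


subsection \<open>Sweedler's Hopf algebra\<close>

lemma k_algebra_op: "k_algebra s m e \<Longrightarrow> k_algebra s (\<lambda>a b. m b a) e"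
  by (auto simp: k_algebra_def k_algebra_axioms_def bilinear_map_def)

lemma vector_space_field: "vector_space ((*) :: 'k::field \<Rightarrow> 'k \<Rightarrow> 'k)"
  by standard (auto simp: algebra_simps)

lemma k_algebra_field: "k_algebra (*) (*) (1 :: 'k::field)"
  by (auto simp: k_algebra_def k_algebra_axioms_def vector_space_field algebra_simps intro!: bilinear_mapI)

lemmas sw_mult_simps [simp] = bilinear_mapD[OF bilinear_bilin_ext, of "\<lambda>(i, j) (i', j').
     if j \<and> j' then 0
     else pscale (if j \<and> i' then -1 else 1) (basis (i \<noteq> i', j \<or> j'))", folded sw_mult_def]

lemma sw_mult_basis [simp]:
  "sw_mult (basis (i, j)) (basis (i', j')) =
    (if j \<and> j' then 0 else pscale (if j \<and> i' then -1 else 1) (basis (i \<noteq> i', j \<or> j')))"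
  by (simp add: sw_mult_def)

lemma k_algebra_sw: "k_algebra pscale sw_mult sw_one"
proof (unfold_locales, goal_cases)
  case 1
  show ?case unfolding sw_mult_def by (rule bilinear_bilin_ext)
next
  case (2 a b c)
  show ?case by (induction a b c rule: basis_induct3) auto
next
  case (3 a)
  show ?case by (induction a rule: basis_induct) (auto simp: sw_one_def)
next
  case (4 a)
  show ?case by (induction a rule: basis_induct) (auto simp: sw_one_def)
qed

text \<open>Together with \<open>sw_relations\<close> and \<open>sw_generated\<close>: the algebra is presented by generators
  \<open>g\<close>, \<open>x\<close> and relations \<open>g\<^sup>2 = 1\<close>, \<open>x\<^sup>2 = 0\<close>, \<open>x g = - g x\<close>.\<close>

lemma sw_hom:
  assumes "k_algebra s m e" "m G G = e" "m X X = 0" "m X G = - m G X"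
  shows "algebra_hom pscale sw_mult sw_one s m e
    (lin_ext s (\<lambda>(i, j). m (alg_pow m e G (of_bool i)) (alg_pow m e X (of_bool j))))"
    (is "algebra_hom _ _ _ _ _ _ ?f")
proof -
  interpret k_algebra s m e by fact
  note M = bilinear_mapD[OF mult_bilinear]
  have R: "m G (m G z) = z" "m X (m X z) = 0" "m X (m G z) = - m G (m X z)" for z
    using assms(2-) by (metis mult_assoc unit_left M(5,7))+
  note L = linear_lin_ext[OF vector_space_axioms]
  have "?f (sw_mult a b) = m (?f a) (?f b)" for a b
  proof (induction a b rule: basis_induct2)
    case (1 a b)
    obtain i j i' j' where ab: "a = (i, j)" "b = (i', j')" by (cases a, cases b)
    show ?case unfolding ab
      by (cases i; cases j; cases i'; cases j')
         (simp_all add: lin_ext_basis[OF vector_space_axioms] linearD[OF L] linear_zero[OF L] linear_minus[OF L]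
            assms(2-) M R mult_assoc unit_left unit_right)
  qed (simp_all add: linearD[OF L] M)
  then show ?thesis
    by (simp add: algebra_hom_def L sw_one_def lin_ext_basis[OF vector_space_axioms] unit_left)
qed

lemma sw_generated:
  assumes "P sw_one" "\<And>a. a \<in> {sw_g, sw_x} \<Longrightarrow> P a" "\<And>u v. P u \<Longrightarrow> P v \<Longrightarrow> P (sw_mult u v)"
    "\<And>u v. P u \<Longrightarrow> P v \<Longrightarrow> P (u + v)" "\<And>c u. P u \<Longrightarrow> P (pscale c u)"
  shows "P u"
proof (induction u rule: basis_induct)
  case (basis b)
  have "P (sw_mult sw_g sw_x)" by (rule assms(3)) (auto intro: assms(2))
  then have gx: "P (basis (True, True))" by (simp add: sw_g_def sw_x_def)
  have g: "P (basis (True, False))" "P (basis (False, True))" "P (basis (False, False))"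
    using assms(1) assms(2)[of sw_g] assms(2)[of sw_x] by (simp_all add: sw_g_def sw_x_def sw_one_def)
  show ?case by (cases b; cases "fst b"; cases "snd b") (use gx g in auto)
qed (rule assms, assumption+)+

lemma sw_relations:
  "sw_mult sw_g sw_g = sw_one" "sw_mult sw_x sw_x = 0" "sw_mult sw_x sw_g = - sw_mult sw_g sw_x"
  by (simp_all add: sw_g_def sw_x_def sw_one_def)

lemma sw_structure:
  shows sw_comult_hom: "algebra_hom pscale sw_mult sw_one pscale (tmult sw_mult sw_mult) (tensor sw_one sw_one)
      (sw_comult :: 'k::field sw \<Rightarrow> _)"
    and sw_counit_hom: "algebra_hom pscale sw_mult sw_one (*) (*) 1 (sw_counit :: 'k sw \<Rightarrow> 'k)"
    and sw_antipode_hom: "algebra_hom pscale sw_mult sw_one pscale (\<lambda>a b. sw_mult b a) sw_one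
      (sw_antipode :: 'k sw \<Rightarrow> _)"
    and sw_comult_gx: "sw_comult sw_g = tensor sw_g (sw_g :: 'k sw)"
      "sw_comult sw_x = tensor sw_x sw_one + tensor sw_g (sw_x :: 'k sw)"
    and sw_counit_gx: "sw_counit sw_g = (1 :: 'k)" "sw_counit sw_x = (0 :: 'k)"
    and sw_antipode_gx: "sw_antipode sw_g = (sw_g :: 'k sw)" "sw_antipode sw_x = (- sw_mult sw_g sw_x :: 'k sw)"
proof -
  interpret A: k_algebra pscale sw_mult "sw_one :: 'k sw" by (rule k_algebra_sw)
  note mb = A.mult_bilinear
  note M = bilinear_mapD[OF mb]
  note V = vector_space_pscale
  note T = tmult_tensor[OF mb mb]
  interpret AA: k_algebra pscale "tmult sw_mult sw_mult" "tensor sw_one (sw_one :: 'k sw)"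
    by (rule k_algebra_tensor[OF k_algebra_sw k_algebra_sw])
  have R: "sw_mult sw_g (sw_mult sw_g z) = z" "sw_mult sw_x (sw_mult sw_x z) = 0"
    "sw_mult sw_x (sw_mult sw_g z) = - sw_mult sw_g (sw_mult sw_x z)" for z :: "'k sw"
    using sw_relations by (metis A.mult_assoc A.unit_left M(5,7))+
  note R = R sw_relations A.unit_left A.unit_right A.mult_assoc
  have comult: "algebra_hom pscale sw_mult sw_one pscale (tmult sw_mult sw_mult) (tensor sw_one sw_one)
    (sw_comult :: 'k sw \<Rightarrow> _)"
    unfolding sw_comult_def Let_def
    by (rule sw_hom[OF AA.k_algebra_axioms]) (simp_all add: T R)
  have comult_gx: "sw_comult sw_g = tensor sw_g (sw_g :: 'k sw)"
    "sw_comult sw_x = tensor sw_x sw_one + tensor sw_g (sw_x :: 'k sw)"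
  proof -
    have "sw_comult (basis (True, False)) = tensor sw_g (sw_g :: 'k sw)"
      "sw_comult (basis (False, True)) = tensor sw_x sw_one + tensor sw_g (sw_x :: 'k sw)"
      by (simp_all add: sw_comult_def Let_def T R)
    then show "sw_comult sw_g = tensor sw_g (sw_g :: 'k sw)"
      "sw_comult sw_x = tensor sw_x sw_one + tensor sw_g (sw_x :: 'k sw)"
      by (simp_all flip: sw_g_def sw_x_def)
  qed
  have antipode_gx: "sw_antipode sw_g = (sw_g :: 'k sw)" "sw_antipode sw_x = (- sw_mult sw_g sw_x :: 'k sw)"
  proof -
    have "sw_antipode (basis (True, False)) = (sw_g :: 'k sw)"
      "sw_antipode (basis (False, True)) = (- sw_mult sw_g sw_x :: 'k sw)"
      by (simp_all add: sw_antipode_def R)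
    then show "sw_antipode sw_g = (sw_g :: 'k sw)" "sw_antipode sw_x = (- sw_mult sw_g sw_x :: 'k sw)"
      by (simp_all flip: sw_g_def sw_x_def)
  qed
  have counit_gx: "sw_counit sw_g = (1 :: 'k)" "sw_counit sw_x = (0 :: 'k)"
    by (simp_all add: sw_counit_def sw_g_def sw_x_def lin_ext_basis[OF vector_space_field])
  have "sw_counit = (lin_ext (*) (\<lambda>(i, j). alg_pow (*) 1 1 (of_bool i) * alg_pow (*) 1 0 (of_bool j)) :: 'k sw \<Rightarrow> 'k)"
    unfolding sw_counit_def by (rule arg_cong[of _ _ "lin_ext (*)"]) auto
  then have counit: "algebra_hom pscale sw_mult sw_one (*) (*) 1 (sw_counit :: 'k sw \<Rightarrow> 'k)"
    using sw_hom[OF k_algebra_field, of "1::'k" 0] by simp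
  let ?m = "\<lambda>a b :: 'k sw. sw_mult b a"
  have "sw_antipode = lin_ext pscale (\<lambda>(i, j). ?m (alg_pow ?m sw_one sw_g (of_bool i))
      (alg_pow ?m sw_one (- sw_mult sw_g sw_x) (of_bool j)))"
    unfolding sw_antipode_def by (rule arg_cong[of _ _ "lin_ext pscale"]) (auto simp: R)
  then have antipode: "algebra_hom pscale sw_mult sw_one pscale ?m sw_one sw_antipode"
    using sw_hom[OF k_algebra_op[OF k_algebra_sw], of sw_g "- sw_mult sw_g sw_x :: 'k sw"] by (simp add: R)
  show "algebra_hom pscale sw_mult sw_one pscale (tmult sw_mult sw_mult) (tensor sw_one sw_one)
      (sw_comult :: 'k sw \<Rightarrow> _)"
    "algebra_hom pscale sw_mult sw_one (*) (*) 1 (sw_counit :: 'k sw \<Rightarrow> 'k)"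
    "algebra_hom pscale sw_mult sw_one pscale (\<lambda>a b. sw_mult b a) sw_one (sw_antipode :: 'k sw \<Rightarrow> _)"
    "sw_comult sw_g = tensor sw_g (sw_g :: 'k sw)"
    "sw_comult sw_x = tensor sw_x sw_one + tensor sw_g (sw_x :: 'k sw)"
    "sw_counit sw_g = (1 :: 'k)" "sw_counit sw_x = (0 :: 'k)"
    "sw_antipode sw_g = (sw_g :: 'k sw)" "sw_antipode sw_x = (- sw_mult sw_g sw_x :: 'k sw)"
    by (fact comult counit antipode comult_gx counit_gx antipode_gx)+
qed

lemma hopf_algebra_sweedler: "hopf_algebra (sweedler_hopf :: (bool \<times> bool, 'k::field) hopf)"
proof -
  interpret A: k_algebra pscale sw_mult "sw_one :: 'k sw" by (rule k_algebra_sw)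
  note mb = A.mult_bilinear
  note M = bilinear_mapD[OF mb]
  note V = vector_space_pscale
  note T = tmult_tensor[OF mb mb]
  interpret AA: k_algebra pscale "tmult sw_mult sw_mult" "tensor sw_one (sw_one :: 'k sw)"
    by (rule k_algebra_tensor[OF k_algebra_sw k_algebra_sw])
  have R: "sw_mult sw_g (sw_mult sw_g z) = z" "sw_mult sw_x (sw_mult sw_x z) = 0"
    "sw_mult sw_x (sw_mult sw_g z) = - sw_mult sw_g (sw_mult sw_x z)" for z :: "'k sw"
    using sw_relations by (metis A.mult_assoc A.unit_left M(5,7))+
  note R = R sw_relations A.unit_left A.unit_right A.mult_assoc
  note comult = sw_comult_hom[where 'k = 'k] and counit = sw_counit_hom[where 'k = 'k]
    and antipode = sw_antipode_hom[where 'k = 'k]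
  note comult_gx = sw_comult_gx[where 'k = 'k] and counit_gx = sw_counit_gx[where 'k = 'k]
    and antipode_gx = sw_antipode_gx[where 'k = 'k]
  have L: "Vector_Spaces.linear pscale pscale (sw_comult :: 'k sw \<Rightarrow> _)"
    "Vector_Spaces.linear pscale pscale (id :: 'k sw \<Rightarrow> _)"
    using algebra_homD(1)[OF comult] algebra_homD(1)[OF algebra_hom_id[OF V, of sw_mult sw_one]] by simp_all
  note C = comult_gx counit_gx antipode_gx algebra_homD(3)[OF comult] algebra_homD(3)[OF counit]
    algebra_homD(3)[OF antipode]
  note LT = linearD[OF linear_tmap] linearD[OF linear_treassoc]
  have SW: "sweedler pscale (\<lambda>a b. pscale (sw_counit a) b) (tensor a b) = pscale (sw_counit a) b"
    "sweedler pscale (\<lambda>a b. pscale (sw_counit b) a) (tensor a b) = pscale (sw_counit b) a"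
    "sweedler pscale (\<lambda>a b. sw_mult (sw_antipode a) b) (tensor a b) = sw_mult (sw_antipode a) b"
    "sweedler pscale (\<lambda>a b. sw_mult a (sw_antipode b)) (tensor a b) = sw_mult a (sw_antipode b)"
    for a b :: "'k sw"
    by (rule sweedler_tensor[OF V], rule bilinear_mapI;
        simp add: V algebra_homD[OF counit] algebra_homD[OF antipode] M pscale.scale_left_distrib
          pscale.scale_right_distrib mult.commute)+
  show ?thesis
    by (rule hopf_algebraI[where G = "{sw_g, sw_x}"], unfold sweedler_hopf_def hopf.simps)
      (fact k_algebra_sw comult counit antipode | (rule sw_generated, assumption+) |
       auto simp: C tmap_tensor[OF L] tmap_tensor[OF L(2,1)] treassoc_tensor LT SW R
         linearD[OF linear_sweedler[OF V]] M)+
qed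

subsection \<open>The Hopf-Ore extension\<close>

lemma algebra_hom_sigma: "algebra_hom pscale sw_mult sw_one pscale sw_mult sw_one sw_sigma"
proof -
  have "sw_sigma (sw_mult a b) = sw_mult (sw_sigma a) (sw_sigma b)" for a b :: "'a sw"
    by (induction a b rule: basis_induct2) (auto simp: sw_sigma_def)
  then show ?thesis
    unfolding algebra_hom_def by (simp add: sw_sigma_def linear_lin_ext[OF vector_space_pscale] sw_one_def)
qed

lemma sigma_generators: "sw_sigma sw_g = - sw_g" "sw_sigma sw_x = - sw_x"
  by (simp_all add: sw_sigma_def sw_g_def sw_x_def)

lemma sigma_sigma: "sw_sigma (sw_sigma a) = a"
  by (induction a rule: basis_induct) (auto simp: sw_sigma_def)

lemma sigma_pow_hom: "algebra_hom pscale sw_mult sw_one pscale sw_mult sw_one (sw_sigma ^^ n)"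
proof (induction n)
  case 0
  show ?case using algebra_hom_id[OF vector_space_pscale, of sw_mult sw_one] by (simp add: id_def)
next
  case (Suc n)
  show ?case using algebra_hom_comp[OF Suc algebra_hom_sigma] by (simp add: comp_def)
qed

lemma linear_ore_monom: "Vector_Spaces.linear pscale pscale (ore_monom n)"
  unfolding ore_monom_def by (rule linear_lin_ext[OF vector_space_pscale])

lemmas ore_monom_simps [simp] = linearD[OF linear_ore_monom] linear_zero[OF linear_ore_monom] linear_minus[OF linear_ore_monom]

lemma ore_monom_basis: "ore_monom n (basis b) = basis (n, b)"
  by (simp add: ore_monom_def)

lemmas ore_mult_bilinear = bilinear_bilin_ext[of "\<lambda>(n, a) (m, b).
     ore_monom (n + m) (sw_mult ((sw_sigma ^^ m) (basis a)) (basis b))", folded ore_mult_def]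

lemmas ore_mult_simps [simp] = bilinear_mapD[OF ore_mult_bilinear]

lemma ore_mult_monom:
  "ore_mult (ore_monom n a) (ore_monom m b) = ore_monom (n + m) (sw_mult ((sw_sigma ^^ m) a) b)"
  by (induction a b rule: basis_induct2)
     (simp_all add: algebra_homD[OF sigma_pow_hom], simp add: ore_monom_basis ore_mult_def)

lemma ore_induct:
  assumes "\<And>n a. P (ore_monom n a)" "\<And>u v. P u \<Longrightarrow> P v \<Longrightarrow> P (u + v)" "\<And>c u. P u \<Longrightarrow> P (pscale c u)"
  shows "P u"
proof (induction u rule: basis_induct)
  show "P (basis b)" for b using assms(1)[of "fst b" "basis (snd b)"] by (simp add: ore_monom_basis)
qed (rule assms, assumption+)+

lemma ore_induct2:
  assumes "\<And>n a m b. P (ore_monom n a) (ore_monom m b)"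
    "\<And>u u' v. P u v \<Longrightarrow> P u' v \<Longrightarrow> P (u + u') v" "\<And>c u v. P u v \<Longrightarrow> P (pscale c u) v"
    "\<And>u v v'. P u v \<Longrightarrow> P u v' \<Longrightarrow> P u (v + v')" "\<And>c u v. P u v \<Longrightarrow> P u (pscale c v)"
  shows "P u v"
proof (rule basis_induct2[of P])
  show "P (basis b) (basis c)" for b c
    using assms(1)[of "fst b" "basis (snd b)" "fst c" "basis (snd c)"] by (simp add: ore_monom_basis)
qed (rule assms, assumption+)+

lemma ore_induct3:
  assumes "\<And>n a m b k c. P (ore_monom n a) (ore_monom m b) (ore_monom k c)"
    "\<And>u u' v w. P u v w \<Longrightarrow> P u' v w \<Longrightarrow> P (u + u') v w" "\<And>c u v w. P u v w \<Longrightarrow> P (pscale c u) v w"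
    "\<And>u v v' w. P u v w \<Longrightarrow> P u v' w \<Longrightarrow> P u (v + v') w" "\<And>c u v w. P u v w \<Longrightarrow> P u (pscale c v) w"
    "\<And>u v w w'. P u v w \<Longrightarrow> P u v w' \<Longrightarrow> P u v (w + w')" "\<And>c u v w. P u v w \<Longrightarrow> P u v (pscale c w)"
  shows "P u v w"
proof (rule basis_induct3[of P])
  show "P (basis b) (basis c) (basis d)" for b c d
    using assms(1)[of "fst b" "basis (snd b)" "fst c" "basis (snd c)" "fst d" "basis (snd d)"]
    by (simp add: ore_monom_basis)
qed (rule assms, assumption+)+

lemma k_algebra_ore: "k_algebra pscale ore_mult ore_one"
proof -
  interpret A: k_algebra pscale sw_mult sw_one by (rule k_algebra_sw)
  note \<sigma> = algebra_homD[OF sigma_pow_hom]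
  show ?thesis
  proof (unfold_locales, goal_cases)
    case 1
    show ?case by (rule ore_mult_bilinear)
  next
    case (2 a b c)
    have [simp]: "(sw_sigma ^^ k) ((sw_sigma ^^ m) a) = (sw_sigma ^^ (m + k)) a" for k m and a :: "'a sw"
      by (metis add.commute comp_apply funpow_add)
    show ?case
      by (induction a b c rule: ore_induct3)
         (simp_all add: ore_mult_monom \<sigma> A.mult_assoc ac_simps)
  next
    case (3 a)
    show ?case
      by (induction a rule: ore_induct) (simp_all add: ore_one_def ore_mult_monom \<sigma> A.unit_left)
  next
    case (4 a)
    show ?case
      by (induction a rule: ore_induct) (simp_all add: ore_one_def ore_mult_monom A.unit_right)
  qed
qed

lemma algebra_hom_ore_embed: "algebra_hom pscale sw_mult sw_one pscale ore_mult ore_one ore_embed"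
  by (simp add: algebra_hom_def linear_ore_monom ore_mult_monom ore_one_def)

lemma ore_y_pow:
  fixes a :: "'k::field sw"
  shows "ore_mult (alg_pow ore_mult ore_one ore_y n) (ore_embed a) = ore_monom n a"
proof -
  interpret A: k_algebra pscale sw_mult "sw_one :: 'k sw" by (rule k_algebra_sw)
  note \<sigma> = algebra_homD[OF sigma_pow_hom]
  have "alg_pow ore_mult ore_one ore_y n = ore_monom n (sw_one :: 'k sw)"
    by (induction n) (simp_all add: ore_one_def ore_y_def ore_mult_monom \<sigma> A.unit_left)
  then show ?thesis by (simp add: ore_mult_monom A.unit_left)
qed

lemma ore_commutation: "ore_mult ore_y (ore_embed a) = ore_mult (ore_embed (sw_sigma a)) ore_y"
proof -
  interpret A: k_algebra pscale sw_mult sw_one by (rule k_algebra_sw)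
  show ?thesis by (simp add: ore_y_def ore_mult_monom sigma_sigma A.unit_left A.unit_right)
qed

text \<open>Together with \<open>ore_commutation\<close> and \<open>ore_generated\<close>: the algebra is generated by Sweedler's
  algebra and \<open>y\<close>, subject to \<open>y a = \<sigma>(a) y\<close>.\<close>

lemma ore_hom:
  assumes "k_algebra s m e" and f: "algebra_hom pscale sw_mult sw_one s m e f"
    and "m (f sw_g) Y = - m Y (f sw_g)" "m (f sw_x) Y = - m Y (f sw_x)"
  shows "algebra_hom pscale ore_mult ore_one s m e
    (lin_ext s (\<lambda>(n, b). m (alg_pow m e Y n) (f (basis b))))"
    (is "algebra_hom _ _ _ _ _ _ ?F")
proof -
  interpret k_algebra s m e by fact
  interpret A: k_algebra pscale sw_mult sw_one by (rule k_algebra_sw)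
  note M = bilinear_mapD[OF mult_bilinear]
  note f = algebra_homD[OF f]
  note \<sigma> = algebra_homD[OF algebra_hom_sigma]
  note L = linear_lin_ext[OF vector_space_axioms]
  have 1: "m (f a) Y = m Y (f (sw_sigma a))" for a
  proof (induction a rule: sw_generated)
    case (3 u v)
    then show ?case by (simp add: \<sigma> f) (metis mult_assoc)
  qed (auto simp: f \<sigma> M unit_left unit_right assms(3,4) sigma_generators)
  have 2: "m (f a) (alg_pow m e Y n) = m (alg_pow m e Y n) (f ((sw_sigma ^^ n) a))" for a n
  proof (induction n arbitrary: a)
    case (Suc n)
    have "m (f a) (m Y (alg_pow m e Y n)) = m (m (f a) Y) (alg_pow m e Y n)"
      by (simp add: mult_assoc)
    also have "\<dots> = m Y (m (f (sw_sigma a)) (alg_pow m e Y n))"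
      by (simp add: 1 mult_assoc)
    finally show ?case by (simp add: Suc mult_assoc flip: funpow_swap1)
  qed (simp add: unit_left unit_right)
  have 3: "m (alg_pow m e Y n) (alg_pow m e Y k) = alg_pow m e Y (n + k)" for n k
    by (induction n) (simp_all add: unit_left mult_assoc)
  have F: "?F (ore_monom n a) = m (alg_pow m e Y n) (f a)" for n a
    by (induction a rule: basis_induct)
       (simp_all add: linearD[OF L] M f, simp add: ore_monom_basis lin_ext_basis[OF vector_space_axioms])
  have "?F (ore_mult a b) = m (?F a) (?F b)" for a b
  proof (induction a b rule: ore_induct2)
    case (1 n a k b)
    have "m (m (alg_pow m e Y n) (f a)) (m (alg_pow m e Y k) (f b)) =
      m (alg_pow m e Y n) (m (m (f a) (alg_pow m e Y k)) (f b))" by (simp add: mult_assoc)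
    also have "\<dots> = m (m (alg_pow m e Y n) (alg_pow m e Y k)) (m (f ((sw_sigma ^^ k) a)) (f b))"
      by (simp add: 2 mult_assoc)
    finally show ?case by (simp add: F ore_mult_monom f 3)
  qed (simp_all add: linearD[OF L] M)
  then show ?thesis
    by (simp add: algebra_hom_def L) (simp add: ore_one_def F f unit_left)
qed

lemma ore_generated:
  assumes "P ore_one" "\<And>a. a \<in> {ore_embed sw_g, ore_embed sw_x, ore_y} \<Longrightarrow> P a" "\<And>u v. P u \<Longrightarrow> P v \<Longrightarrow> P (ore_mult u v)"
    "\<And>u v. P u \<Longrightarrow> P v \<Longrightarrow> P (u + v)" "\<And>c u. P u \<Longrightarrow> P (pscale c u)"
  shows "P u"
proof (induction u rule: ore_induct)
  case (1 n a)
  have "P (ore_embed a)"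
    by (induction a rule: sw_generated)
       (use assms in \<open>auto simp: algebra_homD[OF algebra_hom_ore_embed]\<close>)
  moreover have "P (alg_pow ore_mult ore_one ore_y n)"
    by (induction n) (use assms in auto)
  ultimately show ?case using assms(3) by (metis ore_y_pow)
qed (rule assms, assumption+)+

lemma alg_pow_op:
  assumes "k_algebra s m e"
  shows "alg_pow (\<lambda>a b. m b a) e a n = alg_pow m e a n"
proof -
  interpret k_algebra s m e by fact
  have "m a (alg_pow m e a n) = m (alg_pow m e a n) a" for n
    by (induction n) (simp_all add: unit_left unit_right, metis mult_assoc)
  then show ?thesis by (induction n) simp_all
qed

lemma ore_structure:
  shows ore_comult_hom: "algebra_hom pscale ore_mult ore_one pscale (tmult ore_mult ore_mult) (tensor ore_one ore_one)
      (ore_comult :: 'k::field ore \<Rightarrow> _)"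
    and ore_counit_hom: "algebra_hom pscale ore_mult ore_one (*) (*) 1 (ore_counit :: 'k ore \<Rightarrow> 'k)"
    and ore_antipode_hom: "algebra_hom pscale ore_mult ore_one pscale (\<lambda>a b. ore_mult b a) ore_one
      (ore_antipode :: 'k ore \<Rightarrow> _)"
    and ore_comult_embed: "ore_comult (ore_embed a) = tmap ore_embed ore_embed (sw_comult (a :: 'k sw))"
    and ore_comult_y: "ore_comult ore_y = tensor ore_y ore_one + tensor (ore_embed sw_g) (ore_y :: 'k ore)"
    and ore_counit_embed: "ore_counit (ore_embed a) = sw_counit a"
    and ore_counit_y: "ore_counit ore_y = (0 :: 'k)"
    and ore_antipode_embed: "ore_antipode (ore_embed a) = ore_embed (sw_antipode a)"
    and ore_antipode_y: "ore_antipode ore_y = - ore_mult (ore_embed sw_g) (ore_y :: 'k ore)"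
proof -
  interpret S: k_algebra pscale sw_mult "sw_one :: 'k sw" by (rule k_algebra_sw)
  interpret A: k_algebra pscale ore_mult "ore_one :: 'k ore" by (rule k_algebra_ore)
  note mb = A.mult_bilinear and sb = S.mult_bilinear
  note M = bilinear_mapD[OF mb]
  note V = vector_space_pscale
  note T = tmult_tensor[OF mb mb]
  note E = algebra_hom_ore_embed[where 'a = 'k] and El = linear_ore_monom[of 0, where 'a = 'k]
  note ET = tmap_tensor[OF El El]
  interpret AA: k_algebra pscale "tmult ore_mult ore_mult" "tensor ore_one (ore_one :: 'k ore)"
    by (rule k_algebra_tensor[OF k_algebra_ore k_algebra_ore])
  have R: "sw_mult sw_g (sw_mult sw_g z) = z" "sw_mult sw_x (sw_mult sw_x z) = 0"
    "sw_mult sw_x (sw_mult sw_g z) = - sw_mult sw_g (sw_mult sw_x z)" for z :: "'k sw"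
    using sw_relations by (metis S.mult_assoc S.unit_left bilinear_mapD(5,7)[OF sb])+
  note \<sigma> = algebra_homD[OF algebra_hom_sigma]
  note R = R sw_relations S.unit_left S.unit_right S.mult_assoc sigma_generators \<sigma>
    ore_mult_monom ore_y_def ore_one_def
  let ?\<Delta> = "\<lambda>a :: 'k sw. tmap ore_embed ore_embed (sw_comult a)"
  let ?\<Delta>y = "tensor (ore_y :: 'k ore) ore_one + tensor (ore_embed sw_g) ore_y"
  have D: "algebra_hom pscale sw_mult sw_one pscale (tmult ore_mult ore_mult) (tensor ore_one ore_one) ?\<Delta>"
    by (rule algebra_hom_comp[OF sw_comult_hom algebra_hom_tmap[OF sb sb mb mb E E]])
  show comult: "algebra_hom pscale ore_mult ore_one pscale (tmult ore_mult ore_mult) (tensor ore_one ore_one)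
      (ore_comult :: 'k ore \<Rightarrow> _)"
    unfolding ore_comult_def Let_def
    by (rule ore_hom[OF AA.k_algebra_axioms D])
      (simp_all add: sw_comult_gx ET linearD[OF linear_tmap] T R)
  let ?m = "\<lambda>a b :: 'k ore. ore_mult b a"
  have S: "algebra_hom pscale sw_mult sw_one pscale ?m ore_one (\<lambda>a. ore_embed (sw_antipode a))"
  proof (rule algebra_hom_comp[OF sw_antipode_hom])
    show "algebra_hom pscale (\<lambda>a b. sw_mult b a) sw_one pscale ?m ore_one ore_embed"
      using E by (simp add: algebra_hom_def)
  qed
  have e: "ore_antipode = lin_ext pscale (\<lambda>(n, b). ?m (alg_pow ?m ore_one (- ore_mult (ore_embed sw_g) ore_y) n)
      (ore_embed (sw_antipode (basis b))))"
    unfolding ore_antipode_def alg_pow_op[OF k_algebra_ore] ..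
  show antipode: "algebra_hom pscale ore_mult ore_one pscale ?m ore_one ore_antipode"
    unfolding e by (rule ore_hom[OF k_algebra_op[OF k_algebra_ore] S])
      (simp_all add: sw_antipode_gx R)
  have z: "alg_pow (*) 1 (0 :: 'k) n = (if n = 0 then 1 else 0)" for n
    by (cases n) simp_all
  have e': "ore_counit = lin_ext (*) (\<lambda>(n, b). alg_pow (*) 1 (0 :: 'k) n * sw_counit (basis b))"
    unfolding ore_counit_def
    by (rule arg_cong[of _ _ "lin_ext (*)"]) (auto simp: z)
  show counit: "algebra_hom pscale ore_mult ore_one (*) (*) 1 (ore_counit :: 'k ore \<Rightarrow> 'k)"
    unfolding e' by (rule ore_hom[OF k_algebra_field sw_counit_hom]) (simp_all add: sw_counit_gx)
  note C = algebra_homD[OF comult] algebra_homD[OF D]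
  show "ore_comult (ore_embed a) = ?\<Delta> a"
    by (induction a rule: basis_induct)
       (simp_all add: C, simp add: ore_monom_basis ore_comult_def Let_def AA.unit_left)
  have *: "ore_y = basis (Suc 0, False, False)" "sw_one = basis (False, False)"
    by (simp_all add: ore_y_def sw_one_def ore_monom_basis)
  have 1: "sw_comult (basis (False, False)) = tensor sw_one (sw_one :: 'k sw)"
    "sw_counit (basis (False, False)) = (1 :: 'k)" "sw_antipode (basis (False, False)) = (sw_one :: 'k sw)"
    using algebra_homD(3)[OF sw_comult_hom] algebra_homD(3)[OF sw_counit_hom] algebra_homD(3)[OF sw_antipode_hom]
    by (simp_all flip: *(2))
  have "ore_comult (basis (Suc 0, False, False)) = ?\<Delta>y"
    by (simp add: ore_comult_def Let_def 1 ET AA.unit_left AA.unit_right flip: ore_one_def)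
  then show "ore_comult ore_y = ?\<Delta>y" by (simp flip: *(1))
  have "ore_antipode (basis (Suc 0, False, False)) = - ore_mult (ore_embed sw_g) (ore_y :: 'k ore)"
    by (simp add: ore_antipode_def 1 A.unit_left A.unit_right flip: ore_one_def)
  then show "ore_antipode ore_y = - ore_mult (ore_embed sw_g) (ore_y :: 'k ore)" by (simp flip: *(1))
  show "ore_counit ore_y = (0 :: 'k)"
    by (simp add: ore_counit_def *(1) lin_ext_basis[OF vector_space_field])
  show "ore_counit (ore_embed a) = sw_counit a"
    by (induction a rule: basis_induct)
       (simp_all add: algebra_homD[OF counit] algebra_homD[OF sw_counit_hom],
        simp add: ore_monom_basis ore_counit_def lin_ext_basis[OF vector_space_field])
  show "ore_antipode (ore_embed a) = ore_embed (sw_antipode a)"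
    by (induction a rule: basis_induct)
       (simp_all add: algebra_homD[OF antipode] algebra_homD[OF sw_antipode_hom],
        simp add: ore_monom_basis ore_antipode_def A.unit_right)
qed

lemma hopf_algebra_ore: "hopf_algebra (ore_hopf :: (nat \<times> bool \<times> bool, 'k::field) hopf)"
proof -
  interpret S: k_algebra pscale sw_mult "sw_one :: 'k sw" by (rule k_algebra_sw)
  interpret A: k_algebra pscale ore_mult "ore_one :: 'k ore" by (rule k_algebra_ore)
  note mb = A.mult_bilinear and sb = S.mult_bilinear
  note M = bilinear_mapD[OF mb]
  note V = vector_space_pscale
  have R: "sw_mult sw_g (sw_mult sw_g z) = z" "sw_mult sw_x (sw_mult sw_x z) = 0"
    "sw_mult sw_x (sw_mult sw_g z) = - sw_mult sw_g (sw_mult sw_x z)" for z :: "'k sw"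
    using sw_relations by (metis S.mult_assoc S.unit_left bilinear_mapD(5,7)[OF sb])+
  have Y: "ore_mult (ore_embed a) (ore_mult (ore_embed b) z) = ore_mult (ore_embed (sw_mult a b)) z"
    "ore_mult (ore_embed a) (ore_embed b) = ore_embed (sw_mult a b)" for a b and z :: "'k ore"
    by (simp_all add: ore_mult_monom flip: A.mult_assoc)
  note comult = ore_comult_hom[where 'k = 'k] and counit = ore_counit_hom[where 'k = 'k]
    and antipode = ore_antipode_hom[where 'k = 'k]
  note El = linear_ore_monom[of 0, where 'a = 'k]
  note ET = tmap_tensor[OF El El]
  have L: "Vector_Spaces.linear pscale pscale (ore_comult :: 'k ore \<Rightarrow> _)"
    "Vector_Spaces.linear pscale pscale (id :: 'k ore \<Rightarrow> _)"
    using algebra_homD(1)[OF comult] algebra_homD(1)[OF algebra_hom_id[OF V, of ore_mult ore_one]] by simp_all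
  have O: "ore_embed sw_one = (ore_one :: 'k ore)" by (simp add: ore_one_def)
  note C = sw_comult_gx sw_counit_gx sw_antipode_gx ore_comult_embed ore_comult_y ore_counit_embed
    ore_counit_y ore_antipode_embed ore_antipode_y algebra_homD(3)[OF comult] algebra_homD(3)[OF counit]
    algebra_homD(3)[OF antipode] ET O
  note LT = linearD[OF linear_tmap] linearD[OF linear_treassoc]
  have SW: "sweedler pscale (\<lambda>a b. pscale (ore_counit a) b) (tensor a b) = pscale (ore_counit a) b"
    "sweedler pscale (\<lambda>a b. pscale (ore_counit b) a) (tensor a b) = pscale (ore_counit b) a"
    "sweedler pscale (\<lambda>a b. ore_mult (ore_antipode a) b) (tensor a b) = ore_mult (ore_antipode a) b"
    "sweedler pscale (\<lambda>a b. ore_mult a (ore_antipode b)) (tensor a b) = ore_mult a (ore_antipode b)"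
    for a b :: "'k ore"
    by (rule sweedler_tensor[OF V], rule bilinear_mapI;
        simp add: V algebra_homD[OF counit] algebra_homD[OF antipode] M pscale.scale_left_distrib
          pscale.scale_right_distrib mult.commute)+
  show ?thesis
    by (rule hopf_algebraI[where G = "{ore_embed sw_g, ore_embed sw_x, ore_y}"], unfold ore_hopf_def hopf.simps)
      (fact k_algebra_ore comult counit antipode | (rule ore_generated, assumption+) |
       auto simp: C tmap_tensor[OF L] tmap_tensor[OF L(2,1)] treassoc_tensor LT SW R Y sw_relations
         A.unit_left A.unit_right linearD[OF linear_sweedler[OF V]] M)+
qed

text \<open>A bilinear action of the Hopf-Ore extension may be prescribed on the elements \<open>y\<^sup>n a\<close>.\<close>

lemma ore_action_unique_existence:
  fixes scale :: "'k::field \<Rightarrow> 'r::ab_group_add \<Rightarrow> 'r"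
  assumes "vector_space scale" and \<phi>: "\<And>n. bilinear_map pscale scale scale (\<phi> n)"
  shows "\<exists>!act. bilinear_map pscale scale scale act \<and>
    (\<forall>n a r. act (hmult ore_hopf (hpow ore_hopf ore_y n) (ore_embed a)) r = \<phi> n a r)"
proof -
  interpret vector_space scale by fact
  note M = bilinear_mapD[OF \<phi>]
  note L = linear_lin_ext[OF assms(1)]
  note F = lin_ext_fun[OF assms(1)]
  let ?act = "\<lambda>u r. lin_ext scale (\<lambda>p. \<phi> (fst p) (basis (snd p)) r) u"
  have y: "hmult ore_hopf (hpow ore_hopf ore_y n) (ore_embed a) = ore_monom n a" for n and a :: "'k sw"
    by (simp add: ore_hopf_def ore_y_pow)
  show ?thesis unfolding y
  proof (rule ex1I[of _ ?act], intro conjI allI)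
    show "bilinear_map pscale scale scale ?act"
      by (rule bilinear_mapI) (simp_all add: vector_space_pscale assms(1) linearD[OF L] M F)
    show "?act (ore_monom n a) r = \<phi> n a r" for n a r
      by (induction a rule: basis_induct)
         (simp_all add: linearD[OF L] M, simp add: ore_monom_basis lin_ext_basis[OF assms(1)])
  next
    fix act
    assume *: "bilinear_map pscale scale scale act \<and> (\<forall>n a r. act (ore_monom n a) r = \<phi> n a r)"
    show "act = ?act"
    proof (intro ext)
      fix u r
      note M' = bilinear_mapD[OF conjunct1[OF *]]
      show "act u r = ?act u r"
      proof (induction u rule: basis_induct)
        case (basis b)
        show ?case using conjunct2[OF *, rule_format, of "fst b" "basis (snd b)" r]
          by (simp add: ore_monom_basis lin_ext_basis[OF assms(1)])
      qed (simp_all add: M' linearD[OF L])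
    qed
  qed
qed

end

theory Submission
  imports Defs
begin

text \<open>
  Everything rests on a recursion that the defining sum encodes: for every \<open>h\<close> in the Hopf-Ore
  extension, \<open>y h \<cdot> r = w (h \<cdot> r) - (g h \<cdot> r) w\<close>.  It is the Pascal rule for Gaussian binomial
  coefficients, combined with \<open>g y\<^sup>j = (-1)\<^sup>j y\<^sup>j g\<close> (\<open>ore_sum_Suc\<close>).

  Call a linear map \<open>F\<close> into \<open>R\<close> skew if \<open>F(y h) = w F(h) - F(g h) w\<close>.  If \<open>F\<close>, \<open>G\<close> and \<open>K\<close> are
  skew, then the identity \<open>F(h) = G(h\<^sub>1) K(h\<^sub>2)\<close> passes from \<open>h\<close> and \<open>g h\<close> to \<open>y h\<close>, because
  \<open>\<Delta>(y) = y \<otimes> 1 + g \<otimes> y\<close> makes the mixed terms cancel.  Hence it holds everywhere as soon as it holds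
  at the four basis elements \<open>1\<close>, \<open>g\<close>, \<open>x\<close> and \<open>g x\<close> of Sweedler's algebra
  (\<open>skew_map_product_eqI\<close>).  The three axioms of a symmetric partial action that involve \<open>\<Delta>\<close> are
  all of this form.

  From \<open>g \<cdot> 1 = 0\<close> the action of Sweedler's algebra is determined by \<open>\<Omega>\<close>: \<open>g \<cdot> r = 0\<close>,
  \<open>x \<cdot> r = \<Omega> r\<close>, \<open>g x \<cdot> r = r \<Omega>\<close>, and \<open>\<Omega>\<^sup>2\<close> is central (\<open>sweedler_partial_action_values\<close>).  With
  these values the axioms at the four basis elements are immediate except for one identity,
  \<open>g x k \<cdot> r = (k \<cdot> r) \<Omega> - \<Omega> (g k \<cdot> r)\<close> for all \<open>k\<close>.  It holds for \<open>k\<close> in Sweedler's algebra, and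
  when it holds for \<open>k\<close> and \<open>g k\<close>, the recursion shows that the two sides for \<open>y k\<close> differ by the
  commutator of \<open>g k \<cdot> r\<close> with \<open>w \<Omega> + \<Omega> w\<close>.  So centrality of this element suffices
  (\<open>act_gx_mult\<close>).  It is necessary because \<open>y g\<close> arises in this way from
  \<open>k = g\<close>, for which \<open>g k \<cdot> r = r\<close> is arbitrary (\<open>symmetric_partial_action_iff\<close>).
\<close>

section \<open>Signed Gaussian binomial coefficients at minus one\<close>

lemma qbinom_eq_0: "j < k \<Longrightarrow> qbinom q j k = 0"
  by (induction q j k rule: qbinom.induct) auto

text \<open>At \<open>q = -1\<close>, where \<open>q\<close> and its inverse agree, this is
  \<open>(-1)\<^sup>k q\<^bsup>-k(k-1)/2\<^esup>\<close> times the Gaussian binomial coefficient for \<open>q\<^bsup>-1\<^esup>\<close>.\<close>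

definition ore_coeff :: "nat \<Rightarrow> nat \<Rightarrow> 'k::field" where
  "ore_coeff j k = (-1) ^ k * (-1) powi (- (int (k * (k - 1)) div 2)) * qbinom (-1) j k"

lemma ore_coeff_0 [simp]: "ore_coeff j 0 = 1"
  by (simp add: ore_coeff_def)

lemma ore_coeff_eq_0: "j < k \<Longrightarrow> ore_coeff j k = 0"
  by (simp add: ore_coeff_def qbinom_eq_0)

text \<open>The Pascal rule.  Passing from \<open>k\<close> to \<open>k + 1\<close> multiplies the first sign by \<open>-1\<close> and the second by
  \<open>(-1)\<^sup>k\<close>; together with the factor \<open>(-1)\<^bsup>j-k\<^esup>\<close> of the rule for Gaussian binomials this gives a
  sign that does not depend on \<open>k\<close>.\<close>

lemma ore_coeff_Suc:
  assumes "k \<le> j"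
  shows "ore_coeff (Suc j) (Suc k) = ore_coeff j (Suc k) - (-1) ^ j * (ore_coeff j k :: 'k::field)"
proof -
  have e: "(-1) powi (- (int (m * (m - 1)) div 2)) = ((-1) ^ (m * (m - 1) div 2) :: 'k)" for m
    by (simp add: power_int_minus_one_minus flip: of_nat_mult zdiv_int power_inverse)
       (metis of_nat_numeral power_int_of_nat zdiv_int)
  have t: "Suc k * (Suc k - 1) div 2 = k * (k - 1) div 2 + k"
    by (cases k) (simp_all add: algebra_simps)
  have "(-1) ^ k * (-1) ^ (j - k) = ((-1) ^ j :: 'k)"
    using assms by (simp flip: power_add)
  then have sign: "(-1) ^ Suc k * (-1) ^ (k * (k - 1) div 2 + k) * ((-1) ^ (j - k) * qbinom (-1) j k)
      = - ((-1) ^ j * ((-1) ^ k * (-1) ^ (k * (k - 1) div 2) * qbinom (-1) j k :: 'k))"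
    unfolding power_add by (simp flip: \<open>_ = (-1) ^ j\<close>)
  have "ore_coeff (Suc j) (Suc k) = (ore_coeff j (Suc k) :: 'k) +
      (-1) ^ Suc k * (-1) ^ (k * (k - 1) div 2 + k) * ((-1) ^ (j - k) * qbinom (-1) j k)"
    using assms unfolding ore_coeff_def e t by (simp add: algebra_simps)
  also have "\<dots> = ore_coeff j (Suc k) - (-1) ^ j * ore_coeff j k"
    unfolding sign ore_coeff_def e by simp
  finally show ?thesis .
qed

section \<open>The Hopf-Ore extension\<close>

abbreviation ore_g :: "'k::field ore" where "ore_g \<equiv> ore_embed sw_g"
abbreviation ore_x :: "'k::field ore" where "ore_x \<equiv> ore_embed sw_x"

global_interpretation sw: k_algebra pscale sw_mult "sw_one :: 'k::field sw"
  by (rule k_algebra_sw)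

global_interpretation ore: k_algebra pscale ore_mult "ore_one :: 'k::field ore"
  by (rule k_algebra_ore)

lemma ore_relations:
  "ore_mult ore_g ore_g = ore_one" "ore_mult ore_x ore_x = 0" "ore_mult ore_x ore_g = - ore_mult ore_g ore_x"
  "ore_mult ore_g ore_y = - ore_mult ore_y ore_g" "ore_mult ore_x ore_y = - ore_mult ore_y ore_x"
  by (simp_all add: ore_y_def ore_one_def ore_mult_monom sigma_generators sw_relations sw.unit_left sw.unit_right)

lemma ore_relations_left:
  "ore_mult ore_g (ore_mult ore_g h) = h" "ore_mult ore_x (ore_mult ore_g h) = - ore_mult ore_g (ore_mult ore_x h)"
  "ore_mult ore_g (ore_mult ore_y h) = - ore_mult ore_y (ore_mult ore_g h)"
  "ore_mult ore_x (ore_mult ore_y h) = - ore_mult ore_y (ore_mult ore_x h)"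
  by (simp_all add: ore_relations ore.unit_left flip: ore.mult_assoc)

lemma ore_monom_Suc: "ore_monom (Suc n) a = ore_mult ore_y (ore_monom n a)"
  by (simp add: ore_y_def ore_mult_monom algebra_homD[OF sigma_pow_hom] sw.unit_left)

lemma sw_basis_induct:
  assumes "P sw_one" "P sw_g" "P sw_x" "P (sw_mult sw_g sw_x)"
    "\<And>u v. P u \<Longrightarrow> P v \<Longrightarrow> P (u + v)" "\<And>c u. P u \<Longrightarrow> P (pscale c u)"
  shows "P a"
proof (induction a rule: basis_induct)
  case (basis b)
  show ?case
    using assms(1-4)
    by (cases b; cases "fst b"; cases "snd b") (auto simp: sw_one_def sw_g_def sw_x_def)
qed (rule assms, assumption+)+

text \<open>Recursions along \<open>y\<close> express the value at \<open>y u\<close> by those at \<open>u\<close> and \<open>g u\<close>.  They can be used for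
  induction on the degree in \<open>y\<close>, because left multiplication by \<open>g\<close> preserves this degree.\<close>

lemma ore_left_induct [case_names one g x gx add scale y]:
  assumes "P ore_one" "P ore_g" "P ore_x" "P (ore_mult ore_g ore_x)"
    and add: "\<And>u v. P u \<Longrightarrow> P v \<Longrightarrow> P (u + v)" and scale: "\<And>c u. P u \<Longrightarrow> P (pscale c u)"
    and y: "\<And>u. P u \<Longrightarrow> P (ore_mult ore_g u) \<Longrightarrow> P (ore_mult ore_y u)"
  shows "P h"
proof -
  have "P (ore_monom n a)" for n a
  proof (induction n arbitrary: a)
    case 0
    show ?case
      by (induction a rule: sw_basis_induct)
         (use assms(1-6) in \<open>auto simp: algebra_homD[OF algebra_hom_ore_embed]\<close>)
  next
    case (Suc n)
    have "ore_mult ore_g (ore_monom n a) = ore_monom n (sw_mult ((sw_sigma ^^ n) sw_g) a)"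
      by (simp add: ore_mult_monom)
    then show ?case unfolding ore_monom_Suc using y Suc by metis
  qed
  then show ?thesis by (induction h rule: ore_induct) (use add scale in auto)
qed

lemma ore_comult_mult: "ore_comult (ore_mult a b) = tmult ore_mult ore_mult (ore_comult a) (ore_comult b)"
  by (rule algebra_homD(2)[OF ore_comult_hom])

lemma ore_comult_generators:
  "ore_comult ore_one = tensor ore_one ore_one"
  "ore_comult ore_g = tensor ore_g ore_g"
  "ore_comult ore_x = tensor ore_x ore_one + tensor ore_g ore_x"
  "ore_comult (ore_mult ore_g ore_x) = tensor (ore_mult ore_g ore_x) ore_g + tensor ore_one (ore_mult ore_g ore_x)"
proof -
  note E = tmap_tensor[OF linear_ore_monom linear_ore_monom]
  show 1: "ore_comult ore_one = tensor ore_one ore_one"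
    by (rule algebra_homD(3)[OF ore_comult_hom])
  show g: "ore_comult ore_g = tensor ore_g ore_g"
    by (simp add: ore_comult_embed sw_comult_gx E)
  show x: "ore_comult ore_x = tensor ore_x ore_one + tensor ore_g ore_x"
    by (simp add: ore_comult_embed sw_comult_gx E linearD[OF linear_tmap] flip: ore_one_def)
  show "ore_comult (ore_mult ore_g ore_x) = tensor (ore_mult ore_g ore_x) ore_g + tensor ore_one (ore_mult ore_g ore_x)"
    by (simp add: ore_comult_mult g x tmult_tensor[OF ore_mult_bilinear ore_mult_bilinear] ore_relations ore.unit_right)
qed

section \<open>Skew maps\<close>

text \<open>The behaviour under left multiplication by \<open>y\<close> that the action has in its first argument, isolated
  so that the comultiplication axioms can be treated uniformly.\<close>

definition skew_map :: "('k::field \<Rightarrow> 'r::ring \<Rightarrow> 'r) \<Rightarrow> 'r \<Rightarrow> ('k ore \<Rightarrow> 'r) \<Rightarrow> bool" where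
  "skew_map scale w F \<longleftrightarrow> Vector_Spaces.linear pscale scale F \<and>
     (\<forall>h. F (ore_mult ore_y h) = w * F h - F (ore_mult ore_g h) * w)"

lemma skew_mapD:
  assumes "skew_map scale w F"
  shows "Vector_Spaces.linear pscale scale F" "F (ore_mult ore_y h) = w * F h - F (ore_mult ore_g h) * w"
  using assms by (auto simp: skew_map_def)

locale type_algebra = k_algebra scale "(*)" 1
  for scale :: "'k::field \<Rightarrow> 'r::{ring, monoid_mult} \<Rightarrow> 'r"
begin

lemmas mult_simps = bilinear_mapD[OF mult_bilinear]

lemma bilinear_product:
  assumes "Vector_Spaces.linear pscale scale (F :: ('b \<Rightarrow>\<^sub>0 'k) \<Rightarrow> 'r)"
    "Vector_Spaces.linear pscale scale (G :: ('c \<Rightarrow>\<^sub>0 'k) \<Rightarrow> 'r)"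
  shows "bilinear_map pscale pscale scale (\<lambda>a b. F a * G b)"
  by (rule bilinear_mapI)
     (simp_all add: vector_space_pscale vector_space_axioms linearD[OF assms(1)] linearD[OF assms(2)] mult_simps)

text \<open>The common mechanism behind (PA.2), (PA.3) and (PA.S): the map \<open>h \<mapsto> G(h\<^sub>1) K(h\<^sub>2)\<close> satisfies the
  same recursion along \<open>y\<close> as \<open>F\<close>, so that agreement on Sweedler's algebra is enough.\<close>

lemma skew_map_product_eqI:
  assumes F: "skew_map scale w F" and G: "skew_map scale w G" and K: "skew_map scale w K"
    and one: "F ore_one = G ore_one * K ore_one"
    and g: "F ore_g = G ore_g * K ore_g"
    and x: "F ore_x = G ore_x * K ore_one + G ore_g * K ore_x"
    and gx: "F (ore_mult ore_g ore_x) = G (ore_mult ore_g ore_x) * K ore_g + G ore_one * K (ore_mult ore_g ore_x)"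
  shows "F h = sweedler scale (\<lambda>a b. G a * K b) (ore_comult h)"
proof -
  let ?S = "sweedler scale (\<lambda>a b. G a * K b)" and ?m = "tmult ore_mult ore_mult"
  note F = skew_mapD[OF F] and G = skew_mapD[OF G] and K = skew_mapD[OF K]
  note S = sweedler_tensor[OF vector_space_axioms bilinear_product[OF G(1) K(1)]]
  note SL = linearD[OF linear_sweedler[OF vector_space_axioms]]
  note T = tmult_tensor[OF ore_mult_bilinear ore_mult_bilinear]
  \<comment> \<open>For \<open>t = a \<otimes> b\<close>, the summand \<open>y \<otimes> 1\<close> of \<open>\<Delta>(y)\<close> contributes \<open>- G (g a) * w * K b\<close> and the
    summand \<open>g \<otimes> y\<close> contributes \<open>G (g a) * w * K b\<close>; the two cancel.\<close>
  have comult_y: "?S (?m (ore_comult ore_y) t) = w * ?S t - ?S (?m (ore_comult ore_g) t) * w" for t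
  proof (induction t rule: tensor_induct)
    case (tensor a b)
    show ?case
      by (simp add: ore_comult_y ore_comult_generators T S SL G(2) K(2) ore.unit_left algebra_simps)
  next
    case (add u v)
    then show ?case by (simp add: SL algebra_simps)
  next
    case (scale c u)
    then show ?case by (simp add: SL mult_simps scale_right_diff_distrib)
  qed
  show ?thesis
  proof (induction h rule: ore_left_induct)
    case (y u)
    then show ?case by (simp add: F(2) ore_comult_mult comult_y)
  qed (simp_all add: one g x gx ore_comult_generators S SL linearD[OF F(1)] linearD[OF algebra_homD(1)[OF ore_comult_hom]])
qed

end

section \<open>Actions extended along y\<close>

text \<open>What remains of the hypotheses of the theorem once the action of Sweedler's algebra has been
  determined and the defining sum has been replaced by its recursion.\<close>

locale extended_action = type_algebra scale
  for scale :: "'k::field \<Rightarrow> 'r::{ring, monoid_mult} \<Rightarrow> 'r" +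
  fixes act :: "'k ore \<Rightarrow> 'r \<Rightarrow> 'r" and w \<Omega> :: 'r
  assumes act_bilinear: "bilinear_map pscale scale scale act"
    and act_one: "act ore_one r = r"
    and act_g: "act ore_g r = 0"
    and act_x: "act ore_x r = \<Omega> * r"
    and act_gx: "act (ore_mult ore_g ore_x) r = r * \<Omega>"
    and square_central: "\<Omega> * (\<Omega> * r) = r * (\<Omega> * \<Omega>)"
    and act_y: "act (ore_mult ore_y h) r = w * act h r - act (ore_mult ore_g h) r * w"
begin

lemmas act_simps = bilinear_mapD[OF act_bilinear]

lemma skew_map_act: "skew_map scale w (\<lambda>h. act (ore_mult h k) r)"
  unfolding skew_map_def
  by (auto intro!: linearI simp: vector_space_pscale vector_space_axioms act_simps ore.mult_assoc act_y)

lemma skew_map_act': "skew_map scale w (\<lambda>h. act h r)"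
  using skew_map_act[of ore_one r] by (simp add: ore.unit_right)

lemma act_comult:
  "act h (r * s) = sweedler scale (\<lambda>a b. act a r * act b s) (ore_comult h)"
  by (rule skew_map_product_eqI[OF skew_map_act' skew_map_act' skew_map_act'])
     (simp_all add: act_one act_g act_x act_gx mult.assoc)

text \<open>The content of (PA.3) for \<open>h = g x\<close>, and the place where the centrality of \<open>w \<Omega> + \<Omega> w\<close> is used.
  With \<open>g k\<close> in place of \<open>k\<close>, it is (PA.S) for \<open>h = x\<close>.\<close>

lemma act_gx_mult:
  assumes central: "w * \<Omega> + \<Omega> * w \<in> centre"
  shows "act (ore_mult ore_g (ore_mult ore_x k)) r = act k r * \<Omega> - \<Omega> * act (ore_mult ore_g k) r"
proof (induction k rule: ore_left_induct)
  case (y k)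
  have IH: "act (ore_mult ore_g (ore_mult ore_x k)) r = act k r * \<Omega> - \<Omega> * act (ore_mult ore_g k) r"
    "act (ore_mult ore_x k) r = \<Omega> * act k r - act (ore_mult ore_g k) r * \<Omega>"
    using y by (simp_all add: ore_relations_left act_simps algebra_simps)
  \<comment> \<open>After expanding along \<open>y\<close>, the two sides differ by the commutator of \<open>?b\<close> with \<open>w * \<Omega> + \<Omega> * w\<close>.\<close>
  let ?b = "act (ore_mult ore_g k) r"
  have "(w * \<Omega> + \<Omega> * w) * ?b = ?b * (w * \<Omega> + \<Omega> * w)"
    using central by (simp add: centre_def)
  then show ?case
    by (simp add: ore_relations_left act_simps act_y IH algebra_simps)
next
  case (scale c k)
  then show ?case by (simp add: act_simps mult_simps scale_right_diff_distrib)
qed (simp_all add: ore_relations ore_relations_left ore.unit_left ore.unit_right act_simps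
      act_one act_g act_x act_gx square_central algebra_simps)

lemma act_act:
  assumes central: "w * \<Omega> + \<Omega> * w \<in> centre"
  shows "act h (act k r) = sweedler scale (\<lambda>a b. act a 1 * act (ore_mult b k) r) (ore_comult h)"
  by (rule skew_map_product_eqI[OF skew_map_act' skew_map_act' skew_map_act])
     (simp_all add: act_one act_g act_x act_gx act_gx_mult[OF central] ore.unit_left ore.mult_assoc)

lemma act_act_symmetric:
  assumes central: "w * \<Omega> + \<Omega> * w \<in> centre"
  shows "act h (act k r) = sweedler scale (\<lambda>a b. act (ore_mult a k) r * act b 1) (ore_comult h)"
proof (rule skew_map_product_eqI[OF skew_map_act' skew_map_act skew_map_act'])
  have "act (ore_mult ore_x k) r = \<Omega> * act k r - act (ore_mult ore_g k) r * \<Omega>"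
    using act_gx_mult[OF central, of "ore_mult ore_g k" r]
    by (simp add: ore_relations_left act_simps algebra_simps)
  then show "act ore_x (act k r) = act (ore_mult ore_x k) r * act ore_one 1 + act (ore_mult ore_g k) r * act ore_x 1"
    by (simp add: act_x act_one)
qed (simp_all add: act_one act_g act_gx ore.unit_left)

lemma symmetric_partial_action_iff:
  "symmetric_partial_action ore_hopf scale act \<longleftrightarrow> w * \<Omega> + \<Omega> * w \<in> centre"
proof
  assume "symmetric_partial_action ore_hopf scale act"
  then interpret P: symmetric_partial_action ore_hopf scale act .
  have PA3: "act h (act k r) = sweedler scale (\<lambda>a b. act a 1 * act (ore_mult b k) r) (ore_comult h)" for h k r
    using P.PA3[of h k r] by (simp add: ore_hopf_def)
  note S = sweedler_tensor[OF vector_space_axioms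
      bilinear_product[OF skew_mapD(1)[OF skew_map_act'] skew_mapD(1)[OF skew_map_act]]]
  \<comment> \<open>The choice \<open>k = y g\<close> is made so that \<open>g k \<cdot> s = - (y \<cdot> s) = - w s\<close> and \<open>k \<cdot> s = - s w\<close> have one
    term each.\<close>
  have "(w * \<Omega> + \<Omega> * w) * r = r * (w * \<Omega> + \<Omega> * w)" for r
    using PA3[of "ore_mult ore_g ore_x" "ore_mult ore_y ore_g" r] act_y[of ore_one r]
    by (simp add: ore_comult_generators linearD[OF linear_sweedler[OF vector_space_axioms]] S
        ore.mult_assoc ore_relations ore_relations_left ore.unit_left ore.unit_right act_simps act_y act_one act_g act_x act_gx
        algebra_simps)
  then show "w * \<Omega> + \<Omega> * w \<in> centre"
    by (simp add: centre_def)
next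
  assume central: "w * \<Omega> + \<Omega> * w \<in> centre"
  interpret H: hopf_algebra "ore_hopf :: (nat \<times> bool \<times> bool, 'k) hopf"
    by (rule hopf_algebra_ore)
  show "symmetric_partial_action ore_hopf scale act"
    by unfold_locales
       (simp_all add: ore_hopf_def act_bilinear act_one act_comult
          act_act[OF central, symmetric] act_act_symmetric[OF central, symmetric])
qed

end

section \<open>Partial actions of Sweedler's Hopf algebra\<close>

text \<open>By (PA.2), \<open>g \<cdot> r = (g \<cdot> 1) (g \<cdot> r) = 0\<close>; this turns (PA.2) into one-sided linearity of the actions
  of \<open>x\<close> and \<open>g x\<close>.  The pairs \<open>(g x, g)\<close> and \<open>(g x, g x)\<close> in (PA.3) then give \<open>g x \<cdot> 1 = x \<cdot> 1\<close> and
  the centrality of \<open>(x \<cdot> 1)\<^sup>2\<close>.\<close>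

lemma sweedler_partial_action_values:
  assumes "partial_action sweedler_hopf scale act4" and g1: "act4 sw_g 1 = 0"
  shows "act4 sw_one r = r" "act4 sw_g r = 0" "act4 sw_x r = act4 sw_x 1 * r"
    "act4 (sw_mult sw_g sw_x) r = r * act4 sw_x 1"
    "act4 sw_x 1 * (act4 sw_x 1 * r) = r * (act4 sw_x 1 * act4 sw_x 1)"
proof -
  interpret P: partial_action sweedler_hopf scale act4 by fact
  interpret type_algebra scale ..
  note act4_simps = bilinear_mapD[OF P.act_bilinear]
  have lin: "Vector_Spaces.linear pscale scale (\<lambda>h. act4 (sw_mult h k) r)" for k r
    by (intro linearI) (simp_all add: vector_space_pscale P.R.vector_space_axioms act4_simps)
  have lin1: "Vector_Spaces.linear pscale scale (\<lambda>h. act4 h r)" for r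
    using lin[of sw_one r] by (simp add: sw.unit_right)
  note S = sweedler_tensor[OF P.R.vector_space_axioms bilinear_product[OF lin1 lin1]]
    sweedler_tensor[OF P.R.vector_space_axioms bilinear_product[OF lin1 lin]]
  note SL = linearD[OF linear_sweedler[OF P.R.vector_space_axioms]]
  show one: "act4 sw_one r = r" for r
    using P.PA1 by (simp add: sweedler_hopf_def)
  have PA2: "act4 h (r * s) = sweedler scale (\<lambda>a b. act4 a r * act4 b s) (sw_comult h)" for h r s
    using P.PA2 by (simp add: sweedler_hopf_def)
  have PA3: "act4 h (act4 k r) = sweedler scale (\<lambda>a b. act4 a 1 * act4 (sw_mult b k) r) (sw_comult h)" for h k r
    using P.PA3 by (simp add: sweedler_hopf_def)
  have comult_gx: "sw_comult (sw_mult sw_g sw_x) =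
      tensor (sw_mult sw_g sw_x) sw_g + tensor sw_one (sw_mult sw_g sw_x :: 'a sw)"
    by (simp add: algebra_homD(2)[OF sw_comult_hom] sw_comult_gx sw_relations sw.unit_right
        tmult_tensor[OF sw.mult_bilinear sw.mult_bilinear])
  have gxg: "sw_mult (sw_mult sw_g sw_x) sw_g = (- sw_x :: 'a sw)"
    by (simp add: sw.mult_assoc sw_relations) (simp add: sw_relations sw.unit_left flip: sw.mult_assoc)
  show g: "act4 sw_g r = 0" for r
    using PA2[of sw_g 1 r] by (simp add: sw_comult_gx S g1)
  show x: "act4 sw_x r = act4 sw_x 1 * r" for r
    using PA2[of sw_x 1 r] by (simp add: sw_comult_gx S SL one g)
  have "act4 (sw_mult sw_g sw_x) 1 = act4 sw_x 1"
    using PA3[of "sw_mult sw_g sw_x" sw_g 1]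
    by (simp add: comult_gx S SL one g gxg sw_relations act4_simps)
  then show gx: "act4 (sw_mult sw_g sw_x) r = r * act4 sw_x 1" for r
    using PA2[of "sw_mult sw_g sw_x" r 1] by (simp add: comult_gx S SL one g)
  have gggx: "sw_mult sw_g (sw_mult sw_g sw_x) = (sw_x :: 'a sw)"
    by (simp add: sw_relations sw.unit_left flip: sw.mult_assoc)
  have gxgx: "sw_mult (sw_mult sw_g sw_x) (sw_mult sw_g sw_x) = (0 :: 'a sw)"
    by (simp add: gxg sw_relations flip: sw.mult_assoc)
  show "act4 sw_x 1 * (act4 sw_x 1 * r) = r * (act4 sw_x 1 * act4 sw_x 1)"
    using PA3[of "sw_mult sw_g sw_x" "sw_mult sw_g sw_x" r]
    by (simp add: comult_gx S SL one gx x[of r] gggx gxgx act4_simps mult.assoc)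
qed

section \<open>The recursion along y\<close>

text \<open>The Pascal rule at the level of the defining sum.  With \<open>\<phi> k = g\<^sup>k a \<cdot> r\<close>, the two sums on the right
  are \<open>y\<^sup>j a \<cdot> r\<close> and \<open>y\<^sup>j g a \<cdot> r\<close>.\<close>

lemma (in type_algebra) ore_sum_Suc:
  fixes \<phi> :: "nat \<Rightarrow> 'r"
  shows "(\<Sum>k = 0..Suc j. scale (ore_coeff (Suc j) k) (w ^ (Suc j - k) * \<phi> k * w ^ k)) =
    w * (\<Sum>k = 0..j. scale (ore_coeff j k) (w ^ (j - k) * \<phi> k * w ^ k))
    - scale ((-1) ^ j) (\<Sum>k = 0..j. scale (ore_coeff j k) (w ^ (j - k) * \<phi> (Suc k) * w ^ k)) * w"
proof -
  let ?t = "\<lambda>k. scale (ore_coeff j k) (w ^ (Suc j - k) * \<phi> k * w ^ k)"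
  have "(\<Sum>k = 0..Suc j. scale (ore_coeff (Suc j) k) (w ^ (Suc j - k) * \<phi> k * w ^ k)) =
      ?t 0 + (\<Sum>k = 0..j. scale (ore_coeff (Suc j) (Suc k)) (w ^ (j - k) * \<phi> (Suc k) * w ^ Suc k))"
    by (simp add: sum.atLeast0_atMost_Suc_shift del: power_Suc sum.cl_ivl_Suc)
  also have "(\<Sum>k = 0..j. scale (ore_coeff (Suc j) (Suc k)) (w ^ (j - k) * \<phi> (Suc k) * w ^ Suc k)) =
      (\<Sum>k = 0..j. ?t (Suc k) - scale ((-1) ^ j * ore_coeff j k) (w ^ (j - k) * \<phi> (Suc k) * w ^ Suc k))"
    by (rule sum.cong) (auto simp: ore_coeff_Suc scale_left_diff_distrib)
  also have "\<dots> = (\<Sum>k = 0..j. ?t (Suc k)) -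
      scale ((-1) ^ j) (\<Sum>k = 0..j. scale (ore_coeff j k) (w ^ (j - k) * \<phi> (Suc k) * w ^ k)) * w"
    by (simp add: sum_subtractf sum_distrib_right scale_sum_right mult_simps power_Suc2 mult.assoc
        del: power_Suc)
  also have "?t 0 + \<dots> = (\<Sum>k = 0..Suc j. ?t k) -
      scale ((-1) ^ j) (\<Sum>k = 0..j. scale (ore_coeff j k) (w ^ (j - k) * \<phi> (Suc k) * w ^ k)) * w"
    by (simp add: sum.atLeast0_atMost_Suc_shift del: power_Suc sum.cl_ivl_Suc)
  also have "(\<Sum>k = 0..Suc j. ?t k) = (\<Sum>k = 0..j. ?t k)"
    by (simp add: ore_coeff_eq_0)
  also have "\<dots> = w * (\<Sum>k = 0..j. scale (ore_coeff j k) (w ^ (j - k) * \<phi> k * w ^ k))"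
    by (simp add: sum_distrib_left mult_simps Suc_diff_le mult.assoc)
  finally show ?thesis .
qed

theorem proposition4p11:
  fixes scale :: "'k::{alg_closed_field, field_char_0} \<Rightarrow> 'r::{ring, monoid_mult} \<Rightarrow> 'r"
    and act4 :: "'k sw \<Rightarrow> 'r \<Rightarrow> 'r"
    and act :: "'k ore \<Rightarrow> 'r \<Rightarrow> 'r"
    and w \<Omega> :: 'r
    and q :: 'k
  assumes "partial_action sweedler_hopf scale act4"
    and "act4 sw_g 1 = 0"
    and "\<Omega> = act4 sw_x 1"
    and "q = -1"
    and "bilinear_map pscale scale scale act"
    and "\<And>j a r. act (hmult ore_hopf (hpow ore_hopf ore_y j) (ore_embed a)) r =
      (\<Sum>k = 0..j. scale ((-1) ^ k * q powi (- (int (k * (k - 1)) div 2)) * qbinom (inverse q) j k)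
         (w ^ (j - k) * act4 (hmult sweedler_hopf (hpow sweedler_hopf sw_g k) a) r * w ^ k))"
  shows "symmetric_partial_action ore_hopf scale act \<longleftrightarrow> w * \<Omega> + \<Omega> * w \<in> centre"
proof -
  interpret P: partial_action sweedler_hopf scale act4 by fact
  interpret type_algebra scale ..
  note V = sweedler_partial_action_values[OF assms(1,2), folded assms(3)]
  note act_simps = bilinear_mapD[OF assms(5)]
  let ?g = "\<lambda>k a. sw_mult (alg_pow sw_mult sw_one sw_g k) a"
  have act_monom: "act (ore_monom j a) r =
      (\<Sum>k = 0..j. scale (ore_coeff j k) (w ^ (j - k) * act4 (?g k a) r * w ^ k))" for j a r
    using assms(6)[of j a r] assms(4)
    by (simp add: ore_coeff_def ore_hopf_def sweedler_hopf_def ore_y_pow)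
  have act_embed: "act (ore_embed a) r = act4 a r" for a r
    by (simp add: act_monom sw.unit_left)
  have sigma_g: "(sw_sigma ^^ j) sw_g = pscale ((-1) ^ j) (sw_g :: 'k sw)" for j
  proof (induction j)
    case (Suc j)
    then show ?case
      by (simp add: algebra_homD[OF algebra_hom_sigma] sigma_generators)
  qed simp
  have g_comm: "?g k (sw_mult sw_g a) = ?g (Suc k) a" for k and a :: "'k sw"
  proof -
    have "sw_mult (alg_pow sw_mult sw_one sw_g k) sw_g = sw_mult sw_g (alg_pow sw_mult sw_one (sw_g :: 'k sw) k)"
      by (induction k) (simp_all add: sw.unit_left sw.unit_right sw.mult_assoc)
    then show ?thesis by (simp flip: sw.mult_assoc)
  qed
  have y: "act (ore_mult ore_y h) r = w * act h r - act (ore_mult ore_g h) r * w" for h r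
  proof (induction h rule: ore_induct)
    case (1 j a)
    have "ore_mult ore_g (ore_monom j a) = pscale ((-1) ^ j) (ore_monom j (sw_mult sw_g a))"
      by (simp add: ore_mult_monom sigma_g)
    then have "act (ore_mult ore_g (ore_monom j a)) r =
        scale ((-1) ^ j) (\<Sum>k = 0..j. scale (ore_coeff j k) (w ^ (j - k) * act4 (?g (Suc k) a) r * w ^ k))"
      by (simp only: act_simps act_monom g_comm)
    moreover have "act (ore_mult ore_y (ore_monom j a)) r =
        (\<Sum>k = 0..Suc j. scale (ore_coeff (Suc j) k) (w ^ (Suc j - k) * act4 (?g k a) r * w ^ k))"
      by (simp only: act_monom flip: ore_monom_Suc)
    ultimately show ?case
      by (simp only: ore_sum_Suc act_monom)
  next
    case (2 u v)
    then show ?case by (simp add: act_simps algebra_simps)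
  next
    case (3 c u)
    then show ?case by (simp add: act_simps mult_simps P.R.scale_right_diff_distrib)
  qed
  interpret extended_action scale act w \<Omega>
  proof
    show "act (ore_mult ore_g ore_x) r = r * \<Omega>" for r
      using act_embed[of "sw_mult sw_g sw_x" r]
      by (simp add: algebra_homD(2)[OF algebra_hom_ore_embed] V)
    show "act ore_one r = r" for r
      using act_embed[of sw_one r] by (simp add: V flip: ore_one_def)
  qed (simp_all add: act_embed V y assms(5))
  show ?thesis by (rule symmetric_partial_action_iff)
qed

end
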